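(* Let $P_0,P_1$ be distributions with $\Delta(\ell)<\infty$, and put $A=\Delta(\ell)$ and $C=\min\{D_{KL}(P_1\|P_0),D_{KL}(P_0\|P_1)\}$, where $P_0\ne P_1$ so that $C>0$. Let $X=\{x_1,\dots,x_n\}$ be $n$ data points drawn from $P_0,P_1$ with true change time $k^*\in(1,n]$. Then: (1) The MLE $\hat k$ is $(\alpha,\beta)$-accurate for any $\beta>0$ and $$\alpha=\frac{2A^2}{C^2}\log\frac{32}{3\beta}.$$ (2) For any privacy parameter $\epsilon>0$, $\mathrm{OfflinePCPD}(X,P_0,P_1,\epsilon,0,n)$ is $(\alpha,\beta)$-accurate for any $\beta>0$ and $$\alpha=\max\left\{\frac{8A^2}{C^2}\log\frac{64}{3\beta},\ \frac{4A}{C\epsilon}\log\frac{16}{\beta}\right\}.$$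
   Context: $P_0,P_1$ are probability distributions on $\mathbb{R}$, and $P_0(x),P_1(x)$ denote their densities (or mass functions) with respect to a common reference measure. $\log$ is the natural logarithm, with the convention $\log\frac00=0$. $D_{KL}(P\|Q)=\mathbb{E}_{x\sim P}\left[\log\frac{P(x)}{Q(x)}\right]$. Data $X=\{x_1,\dots,x_n\}$ are drawn from $P_0,P_1$ with true change time $k^*$ if $x_1,\dots,x_n$ are independent, $x_1,\dots,x_{k^*-1}$ are distributed as $P_0$, and $x_{k^*},\dots,x_n$ are distributed as $P_1$; $k^*$ is an integer. For $k\in\{1,\dots,n\}$, set $\ell(k)=\ell(k,X)=\sum_{i=k}^n\log\frac{P_1(x_i)}{P_0(x_i)}$. The maximum likelihood estimator (MLE) is $\hat k=\mathrm{argmax}_{k\in\{1,\dots,n\}}\ell(k)$. The sensitivity is $$\Delta(\ell)=\max_{x\in\mathbb{R}}\log\frac{P_1(x)}{P_0(x)}-\min_{x'\in\mathbb{R}}\log\frac{P_1(x')}{P_0(x')}$$ (max/min are read as supremum/infimum if not attained). A (possibly randomized) change-point estimator $\tilde k(X)$ is $(\alpha,\beta)$-accurate if $\Pr[|\tilde k-k^*|<\alpha]\ge 1-\beta$, the probability being over the randomness of the algorithm and the sampling of $X$. $\mathrm{Lap}(b)$ is the Laplace distribution with density $\frac1{2b}e^{-|x|/b}$. Algorithm $\mathrm{OfflinePCPD}(X,P_0,P_1,\epsilon,0,n)$ (the case $\delta=0$): let $A=\Delta(\ell)$; draw $Z_1,\dots,Z_n$ i.i.d. from $\mathrm{Lap}(A/\epsilon)$,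 independent of $X$; output $\tilde k=\mathrm{argmax}_{1\le k\le n}\{\ell(k)+Z_k\}$. *)

theory Defs
  imports "HOL-Probability.Probability"
begin

text \<open>
  The value of \<open>log (p x / q x)\<close> lies in the extended reals, so that finiteness of the
  sensitivity below is a genuine condition; real-valued \<open>ln\<close> would turn the
  infinite values into \<open>0\<close>. The convention is \<open>log (0/0) = 0\<close>.
\<close>

definition log_ratio :: "(real \<Rightarrow> real) \<Rightarrow> (real \<Rightarrow> real) \<Rightarrow> real \<Rightarrow> ereal" where
  "log_ratio p q x =
     (if p x = 0 \<and> q x = 0 then 0
      else if q x = 0 then \<infinity>
      else if p x = 0 then -\<infinity>
      else ereal (ln (p x / q x)))"

definition sensitivity :: "(real \<Rightarrow> real) \<Rightarrow> (real \<Rightarrow> real) \<Rightarrow> ereal" where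
  "sensitivity p0 p1 = (SUP x. log_ratio p1 p0 x) - (INF x. log_ratio p1 p0 x)"

text \<open>Taking \<open>real_of_ereal\<close> loses nothing when the sensitivity is finite, as all log-ratios are
  then finite.\<close>

definition loglik :: "(real \<Rightarrow> real) \<Rightarrow> (real \<Rightarrow> real) \<Rightarrow> nat \<Rightarrow> (nat \<Rightarrow> real) \<Rightarrow> nat \<Rightarrow> real" where
  "loglik p0 p1 n X k = (\<Sum>i=k..n. real_of_ereal (log_ratio p1 p0 (X i)))"

text \<open>\<open>KL_divergence b M N\<close> integrates over its second measure argument, hence the swap.\<close>

definition D_KL :: "real measure \<Rightarrow> real measure \<Rightarrow> real" where
  "D_KL P Q = KL_divergence (exp 1) Q P"

definition drawn_with_change ::
  "'w measure \<Rightarrow> real measure \<Rightarrow> real measure \<Rightarrow> nat \<Rightarrow> nat \<Rightarrow> (nat \<Rightarrow> 'w \<Rightarrow> real) \<Rightarrow> bool" where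
  "drawn_with_change \<Omega> P0 P1 n kstar X \<longleftrightarrow>
     prob_space.indep_vars \<Omega> (\<lambda>_. borel) X {1..n} \<and>
     (\<forall>i\<in>{1..n}. distr \<Omega> borel (X i) = (if i < kstar then P0 else P1))"

text \<open>Estimators are random variables on the space \<open>\<Omega>\<close>, which carries both the sample and the
  randomness of the algorithm.\<close>

definition accurate ::
  "'w measure \<Rightarrow> nat \<Rightarrow> real \<Rightarrow> real \<Rightarrow> ('w \<Rightarrow> nat) \<Rightarrow> bool" where
  "accurate \<Omega> kstar \<alpha> \<beta> k \<longleftrightarrow>
     measure \<Omega> {\<omega>\<in>space \<Omega>. \<bar>real (k \<omega>) - real kstar\<bar> < \<alpha>} \<ge> 1 - \<beta>"

text \<open>A maximiser need not be unique; the next definitions admit every measurable choice.\<close>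

definition is_MLE ::
  "'w measure \<Rightarrow> (real \<Rightarrow> real) \<Rightarrow> (real \<Rightarrow> real) \<Rightarrow> nat \<Rightarrow> (nat \<Rightarrow> 'w \<Rightarrow> real) \<Rightarrow> ('w \<Rightarrow> nat) \<Rightarrow> bool" where
  "is_MLE \<Omega> p0 p1 n X khat \<longleftrightarrow>
     khat \<in> measurable \<Omega> (count_space UNIV) \<and>
     (\<forall>\<omega>\<in>space \<Omega>. is_arg_max (loglik p0 p1 n (\<lambda>i. X i \<omega>)) (\<lambda>k. k \<in> {1..n}) (khat \<omega>))"

definition laplace_density :: "real \<Rightarrow> real \<Rightarrow> real" where
  "laplace_density b x = exp (- \<bar>x\<bar> / b) / (2 * b)"

text \<open>\<open>ktilde\<close> is the output of one run of OfflinePCPD with \<open>\<delta> = 0\<close> on the sample \<open>X\<close>.\<close>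

definition is_OfflinePCPD ::
  "'w measure \<Rightarrow> (real \<Rightarrow> real) \<Rightarrow> (real \<Rightarrow> real) \<Rightarrow> real \<Rightarrow> nat \<Rightarrow> (nat \<Rightarrow> 'w \<Rightarrow> real) \<Rightarrow>
     ('w \<Rightarrow> nat) \<Rightarrow> bool" where
  "is_OfflinePCPD \<Omega> p0 p1 \<epsilon> n X ktilde \<longleftrightarrow>
     ktilde \<in> measurable \<Omega> (count_space UNIV) \<and>
     (\<exists>Z :: nat \<Rightarrow> 'w \<Rightarrow> real.
        prob_space.indep_vars \<Omega> (\<lambda>_. borel) Z {1..n} \<and>
        (\<forall>k\<in>{1..n}. distributed \<Omega> lborel (Z k)
           (\<lambda>z. ennreal (laplace_density (real_of_ereal (sensitivity p0 p1) / \<epsilon>) z))) \<and>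
        prob_space.indep_var \<Omega>
          (PiM {1..n} (\<lambda>_. borel)) (\<lambda>\<omega>. \<lambda>i\<in>{1..n}. X i \<omega>)
          (PiM {1..n} (\<lambda>_. borel)) (\<lambda>\<omega>. \<lambda>k\<in>{1..n}. Z k \<omega>) \<and>
        (\<forall>\<omega>\<in>space \<Omega>.
           is_arg_max (\<lambda>k. loglik p0 p1 n (\<lambda>i. X i \<omega>) k + Z k \<omega>) (\<lambda>k. k \<in> {1..n}) (ktilde \<omega>)))"

end

theory Submission
  imports Defs "HOL-Real_Asymp.Real_Asymp"
begin

text \<open>
  To the right of the change point, \<open>\<ell>(k*) - \<ell>(k* + m)\<close> is a random walk whose steps have mean at
  least \<open>C\<close> and lie in an interval of length \<open>A\<close>; to the left the same holds with the signs
  reversed. By Hoeffding's lemma the exponential of the walk minus a line of smaller slope, with a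
  suitable negative factor, is a supermartingale, so Ville's maximal inequality bounds the
  probability that the walk ever falls below the line, uniformly in time. For the MLE this is all
  that is needed.

  For the noisy estimator, comparing every far index with \<open>k*\<close> alone is too weak when \<open>\<epsilon>\<close> is small:
  the number of far indices that compete is of order \<open>1/\<epsilon>\<close>. Instead, with \<open>a = \<lceil>\<alpha>\<rceil>\<close>, the far
  index \<open>k* + m\<close> is compared with the near index \<open>k* + (m mod a)\<close>. The walk almost always increases by
  at least \<open>\<lfloor>m / a\<rfloor> a C / 2\<close> between these two, and then the exponential tail of the Laplace
  distribution makes the far index much less likely to win against the near block than its partner.
  As at most one near index wins, the winning probabilities of the partners add up to at most one,
  regardless of the number of indices.
\<close>

subsection \<open>Maximal inequalities for random walks\<close>

text \<open>Walks will run backwards from a time or start at a later one, so their steps get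
  renumbered. The product formula over a finite \<open>K\<close> is the one over its image, each
  event being carried along by the inverse of \<open>f\<close> on \<open>K\<close>.\<close>

lemma (in prob_space) indep_vars_inj_reindex:
  assumes "indep_vars (\<lambda>_. N) X I" "inj_on f J" "f ` J \<subseteq> I"
  shows "indep_vars (\<lambda>_. N) (\<lambda>j. X (f j)) J"
proof -
  have rv: "\<And>i. i \<in> I \<Longrightarrow> random_variable N (X i)"
    and ind: "indep_sets (\<lambda>i. {X i -` A \<inter> space M |A. A \<in> sets N}) I"
    using assms(1) unfolding indep_vars_def2 by auto
  have "indep_sets (\<lambda>j. {X (f j) -` A \<inter> space M |A. A \<in> sets N}) J"
  proof (rule indep_setsI)
    show "{X (f j) -` A \<inter> space M |A. A \<in> sets N} \<subseteq> events" if "j \<in> J" for j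
      using rv[of "f j"] that assms(3) by (auto intro: measurable_sets)
    fix A K assume K: "K \<noteq> {}" "K \<subseteq> J" "finite K"
      and A: "\<forall>j\<in>K. A j \<in> {X (f j) -` A \<inter> space M |A. A \<in> sets N}"
    have inj: "inj_on f K" using assms(2) K(2) by (rule inj_on_subset)
    define B where "B = (\<lambda>i. A (the_inv_into K f i))"
    have B: "B (f j) = A j" if "j \<in> K" for j
      using that inj by (simp add: B_def the_inv_into_f_f)
    have "prob (\<Inter>i\<in>f ` K. B i) = (\<Prod>i\<in>f ` K. prob (B i))"
      by (rule indep_setsD[OF ind]) (use K assms(3) A B in auto)
    then show "prob (\<Inter>j\<in>K. A j) = (\<Prod>j\<in>K. prob (A j))"
      using B inj by (simp add: prod.reindex cong: INF_cong_simp prod.cong)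
  qed
  then show ?thesis
    using rv assms(3) unfolding indep_vars_def2 by auto
qed

text \<open>The product formula for a family indexed by the Booleans. Values in
  \<open>ennreal\<close> spare all integrability conditions.\<close>

lemma (in prob_space) indep_var_nn_integral_mult:
  fixes X Y :: "'a \<Rightarrow> ennreal"
  assumes "indep_var borel X borel Y"
  shows "(\<integral>\<^sup>+\<omega>. X \<omega> * Y \<omega> \<partial>M) = (\<integral>\<^sup>+\<omega>. X \<omega> \<partial>M) * (\<integral>\<^sup>+\<omega>. Y \<omega> \<partial>M)"
proof -
  have b: "case_bool borel borel = (\<lambda>_. borel :: ennreal measure)"
    by (auto split: bool.split)
  have "indep_vars (\<lambda>_. borel) (case_bool X Y) UNIV"
    using assms unfolding indep_var_def b .
  from indep_vars_nn_integral[OF _ this] show ?thesis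
    by (simp add: UNIV_bool mult.commute)
qed

text \<open>For independent factors of mean at most one these stopped products have expectation at most
  one, so Markov's inequality for the last of them is Ville's maximal inequality.\<close>

primrec stopped_prod :: "real \<Rightarrow> (nat \<Rightarrow> real) \<Rightarrow> nat \<Rightarrow> real" where
  "stopped_prod K y 0 = 1"
| "stopped_prod K y (Suc m) =
     (if stopped_prod K y m \<ge> K then stopped_prod K y m else stopped_prod K y m * y m)"

lemma stopped_prod_nonneg: "(\<And>i. i < m \<Longrightarrow> y i \<ge> 0) \<Longrightarrow> stopped_prod K y m \<ge> 0"
  by (induction m) auto

lemma stopped_prod_cong: "(\<And>i. i < m \<Longrightarrow> y i = y' i) \<Longrightarrow> stopped_prod K y m = stopped_prod K y' m"
  by (induction m) auto

lemma measurable_stopped_prod: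
  "m \<le> n \<Longrightarrow> (\<lambda>y. stopped_prod K y m) \<in> borel_measurable (PiM {..<n} (\<lambda>_. borel))"
proof (induction m)
  case (Suc m)
  then have [measurable]: "(\<lambda>y. stopped_prod K y m) \<in> borel_measurable (PiM {..<n} (\<lambda>_. borel))"
    by simp
  have [measurable]: "(\<lambda>y. y m) \<in> borel_measurable (PiM {..<n} (\<lambda>_. borel :: real measure))"
    using Suc.prems by (intro measurable_component_singleton) auto
  show ?case by simp
qed simp

text \<open>The stopped product is the plain product until it first reaches \<open>K\<close>, and it
  is frozen from then on. So an event about some time up to \<open>N\<close> becomes an event about
  time \<open>N\<close> alone.\<close>

lemma stopped_prod_ge:
  assumes "m \<le> N" "(\<Prod>i<m. y i) \<ge> K"
  shows "stopped_prod K y N \<ge> K"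
proof -
  have *: "stopped_prod K y l \<ge> K \<or> stopped_prod K y l = (\<Prod>i<l. y i)" for l
    by (induction l) auto
  have "stopped_prod K y m \<ge> K" using *[of m] assms by auto
  with \<open>m \<le> N\<close> show ?thesis by (induction N rule: dec_induct) auto
qed

text \<open>Induction on time: the stopped product at time \<open>m\<close> is a function of the
  factors before \<open>m\<close>, hence independent of \<open>Y m\<close>, and a further factor of
  mean at most one cannot raise the expectation.\<close>

lemma (in prob_space) nn_integral_stopped_prod_le:
  fixes Y :: "nat \<Rightarrow> 'a \<Rightarrow> real"
  assumes indep: "indep_vars (\<lambda>_. borel) Y {..<N}"
    and nonneg: "\<And>i \<omega>. i < N \<Longrightarrow> Y i \<omega> \<ge> 0"
    and le: "\<And>i. i < N \<Longrightarrow> (\<integral>\<^sup>+\<omega>. ennreal (Y i \<omega>) \<partial>M) \<le> 1"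
    and "m \<le> N"
  shows "(\<integral>\<^sup>+\<omega>. ennreal (stopped_prod K (\<lambda>i. Y i \<omega>) m) \<partial>M) \<le> 1"
  using \<open>m \<le> N\<close>
proof (induction m)
  case 0
  then show ?case by (simp add: emeasure_space_1)
next
  case (Suc m)
  then have m: "m < N" by simp
  have [measurable]: "Y m \<in> borel_measurable M"
    using indep m by (auto simp: indep_vars_def)
  let ?T = "\<lambda>\<omega>. stopped_prod K (\<lambda>i. Y i \<omega>) m"
  have ind: "indep_var (PiM {..<m} (\<lambda>_. borel)) (\<lambda>\<omega>. \<lambda>i\<in>{..<m}. Y i \<omega>)
      (PiM {m} (\<lambda>_. borel)) (\<lambda>\<omega>. \<lambda>i\<in>{m}. Y i \<omega>)"
    by (rule indep_var_restrict[OF indep]) (use m in auto)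
  have restr: "stopped_prod K (\<lambda>i\<in>{..<m}. Y i \<omega>) m = ?T \<omega>" for \<omega>
    by (rule stopped_prod_cong) auto
  have T_m [measurable]: "?T \<in> borel_measurable M"
  proof -
    have "(\<lambda>y. stopped_prod K y m) \<circ> (\<lambda>\<omega>. \<lambda>i\<in>{..<m}. Y i \<omega>) \<in> borel_measurable M"
      by (rule measurable_comp[OF indep_var_rv1[OF ind] measurable_stopped_prod]) simp
    then show ?thesis by (simp add: comp_def restr)
  qed
  define g where "g = (\<lambda>t::real. if K \<le> t then 0 else ennreal t)"
  have [measurable]: "g \<in> borel_measurable borel" unfolding g_def by measurable
  have "indep_var borel ((\<lambda>y. g (stopped_prod K y m)) \<circ> (\<lambda>\<omega>. \<lambda>i\<in>{..<m}. Y i \<omega>))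
      borel ((\<lambda>y. ennreal (y m)) \<circ> (\<lambda>\<omega>. \<lambda>i\<in>{m}. Y i \<omega>))"
  proof (rule indep_var_compose[OF ind])
    show "(\<lambda>y. g (stopped_prod K y m)) \<in> borel_measurable (PiM {..<m} (\<lambda>_. borel))"
      by (rule measurable_compose[OF measurable_stopped_prod]) simp_all
    have [measurable]: "(\<lambda>y. y m) \<in> borel_measurable (PiM {m} (\<lambda>_. borel :: real measure))"
      by (intro measurable_component_singleton) auto
    show "(\<lambda>y. ennreal (y m)) \<in> borel_measurable (PiM {m} (\<lambda>_. borel))"
      by measurable
  qed
  then have ind': "indep_var borel (\<lambda>\<omega>. g (?T \<omega>)) borel (\<lambda>\<omega>. ennreal (Y m \<omega>))"
    by (simp add: comp_def restr)
  have nn: "0 \<le> ?T \<omega>" for \<omega>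
    by (rule stopped_prod_nonneg) (use m nonneg in auto)
  have "(\<integral>\<^sup>+\<omega>. ennreal (stopped_prod K (\<lambda>i. Y i \<omega>) (Suc m)) \<partial>M) =
      (\<integral>\<^sup>+\<omega>. (if K \<le> ?T \<omega> then ennreal (?T \<omega>) else 0) + g (?T \<omega>) * ennreal (Y m \<omega>) \<partial>M)"
    by (intro nn_integral_cong) (auto simp: g_def ennreal_mult'' nonneg m)
  also have "\<dots> = (\<integral>\<^sup>+\<omega>. (if K \<le> ?T \<omega> then ennreal (?T \<omega>) else 0) \<partial>M) +
      (\<integral>\<^sup>+\<omega>. g (?T \<omega>) \<partial>M) * (\<integral>\<^sup>+\<omega>. ennreal (Y m \<omega>) \<partial>M)"
    unfolding indep_var_nn_integral_mult[OF ind', symmetric]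
    by (intro nn_integral_add) measurable
  also have "\<dots> \<le> (\<integral>\<^sup>+\<omega>. (if K \<le> ?T \<omega> then ennreal (?T \<omega>) else 0) \<partial>M) +
      (\<integral>\<^sup>+\<omega>. g (?T \<omega>) \<partial>M) * 1"
    by (intro add_left_mono mult_left_mono le[OF m]) auto
  also have "\<dots> = (\<integral>\<^sup>+\<omega>. (if K \<le> ?T \<omega> then ennreal (?T \<omega>) else 0) + g (?T \<omega>) \<partial>M)"
    by (subst nn_integral_add) measurable
  also have "\<dots> = (\<integral>\<^sup>+\<omega>. ennreal (?T \<omega>) \<partial>M)"
    by (intro nn_integral_cong) (auto simp: g_def)
  also have "\<dots> \<le> 1" using Suc by simp
  finally show ?case .
qed

lemma (in prob_space) prob_prod_reaches_le:
  fixes Y :: "nat \<Rightarrow> 'a \<Rightarrow> real"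
  assumes indep: "indep_vars (\<lambda>_. borel) Y {..<N}"
    and nonneg: "\<And>i \<omega>. i < N \<Longrightarrow> Y i \<omega> \<ge> 0"
    and le: "\<And>i. i < N \<Longrightarrow> (\<integral>\<^sup>+\<omega>. ennreal (Y i \<omega>) \<partial>M) \<le> 1"
    and "K > 0"
  shows "prob {\<omega>\<in>space M. \<exists>m\<le>N. (\<Prod>i<m. Y i \<omega>) \<ge> K} \<le> 1 / K"
proof -
  have rv [measurable]: "i < N \<Longrightarrow> Y i \<in> borel_measurable M" for i
    using indep by (auto simp: indep_vars_def)
  let ?T = "\<lambda>\<omega>. stopped_prod K (\<lambda>i. Y i \<omega>) N"
  have [measurable]: "(\<lambda>\<omega>. stopped_prod K (\<lambda>i. Y i \<omega>) m) \<in> borel_measurable M" if "m \<le> N" for m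
    using that
  proof (induction m)
    case (Suc m)
    then have [measurable]: "(\<lambda>\<omega>. stopped_prod K (\<lambda>i. Y i \<omega>) m) \<in> borel_measurable M"
      "Y m \<in> borel_measurable M" using rv by auto
    show ?case by simp
  qed simp
  have T [measurable]: "?T \<in> borel_measurable M" by measurable
  have "emeasure M {\<omega>\<in>space M. \<exists>m\<le>N. (\<Prod>i<m. Y i \<omega>) \<ge> K} \<le>
      emeasure M {\<omega>\<in>space M. 1 \<le> ennreal (1 / K) * ennreal (?T \<omega>)}"
  proof (rule emeasure_mono)
    show "{\<omega>\<in>space M. \<exists>m\<le>N. (\<Prod>i<m. Y i \<omega>) \<ge> K} \<subseteq>
        {\<omega>\<in>space M. 1 \<le> ennreal (1 / K) * ennreal (?T \<omega>)}"
    proof safe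
      fix \<omega> m assume "\<omega> \<in> space M" "m \<le> N" "K \<le> (\<Prod>i<m. Y i \<omega>)"
      then have "K \<le> ?T \<omega>" using stopped_prod_ge by blast
      then have "1 \<le> 1 / K * ?T \<omega>" using \<open>K > 0\<close> by (simp add: field_simps)
      then have "ennreal 1 \<le> ennreal (1 / K * ?T \<omega>)" by (rule ennreal_leI)
      then show "1 \<le> ennreal (1 / K) * ennreal (?T \<omega>)"
        using \<open>K > 0\<close> by (simp only: ennreal_mult' ennreal_1 zero_le_divide_1_iff less_imp_le)
    qed
  qed measurable
  also have "\<dots> \<le> ennreal (1 / K) * (\<integral>\<^sup>+\<omega>. ennreal (?T \<omega>) * indicator (space M) \<omega> \<partial>M)"
    using nn_integral_Markov_inequality[where u = "\<lambda>\<omega>. ennreal (?T \<omega>)" and M = M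
        and A = "space M" and c = "ennreal (1 / K)"] T
    by simp
  also have "(\<integral>\<^sup>+\<omega>. ennreal (?T \<omega>) * indicator (space M) \<omega> \<partial>M) = (\<integral>\<^sup>+\<omega>. ennreal (?T \<omega>) \<partial>M)"
    by (intro nn_integral_cong) auto
  also have "ennreal (1 / K) * \<dots> \<le> ennreal (1 / K) * 1"
    by (intro mult_left_mono nn_integral_stopped_prod_le[OF indep nonneg le]) auto
  finally show ?thesis
    using \<open>K > 0\<close> by (simp add: emeasure_eq_measure)
qed

section \<open>Walks with drift and the lines below them\<close>

text \<open>The exponential of \<open>- \<kappa>\<close> times the walk minus
  \<open>\<theta> * m * C\<close> is a product of independent factors. The walk meets the lowered
  line exactly when this product reaches \<open>exp (\<kappa> * h)\<close>.\<close>

lemma (in prob_space) prob_walk_crosses_line_le: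
  fixes U :: "nat \<Rightarrow> 'a \<Rightarrow> real"
  assumes indep: "indep_vars (\<lambda>_. borel) U {..<N}"
    and range: "\<And>i \<omega>. i < N \<Longrightarrow> U i \<omega> \<in> {l..l + A}"
    and mean: "\<And>i. i < N \<Longrightarrow> expectation (U i) \<ge> C"
    and pos: "A > 0" "C > 0" "\<theta> < 1"
  shows "prob {\<omega>\<in>space M. \<exists>m\<le>N. (\<Sum>i<m. U i \<omega>) \<le> \<theta> * m * C - h}
      \<le> exp (- (8 * (1 - \<theta>) * C * h / A\<^sup>2))"
proof -
  \<comment> \<open>The largest rate at which Hoeffding's lemma bounds the mean of every factor by
    one: it solves \<open>\<kappa> * A\<^sup>2 / 8 = (1 - \<theta>) * C\<close>.\<close>
  define \<kappa> where "\<kappa> = 8 * (1 - \<theta>) * C / A\<^sup>2"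
  have \<kappa>: "\<kappa> > 0" using pos by (simp add: \<kappa>_def)
  define Y where "Y = (\<lambda>i \<omega>. exp (- \<kappa> * (U i \<omega> - \<theta> * C)))"
  have rv [measurable]: "i < N \<Longrightarrow> U i \<in> borel_measurable M" for i
    using indep by (auto simp: indep_vars_def)
  have indY: "indep_vars (\<lambda>_. borel) Y {..<N}"
    unfolding Y_def by (rule indep_vars_compose2[OF indep]) measurable
  have leY: "(\<integral>\<^sup>+\<omega>. ennreal (Y i \<omega>) \<partial>M) \<le> 1" if i: "i < N" for i
  proof -
    define E where "E = expectation (U i)"
    have EC: "E \<ge> C" using mean i by (simp add: E_def)
    \<comment> \<open>Negated because Hoeffding's lemma is applied with a positive rate, while it is
      the small values of \<open>U i\<close> that have to be controlled.\<close>
    interpret V: interval_bounded_random_variable M "\<lambda>\<omega>. - U i \<omega>" "- (l + A)" "- l"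
    proof
      show "(\<lambda>\<omega>. - U i \<omega>) \<in> borel_measurable M"
        using rv[OF i] by (rule borel_measurable_uminus)
      show "AE \<omega> in M. - U i \<omega> \<in> {- (l + A)..- l}"
      proof (rule AE_I2)
        show "- U i \<omega> \<in> {- (l + A)..- l}" for \<omega>
          using range[OF i, of \<omega>] by auto
      qed
    qed
    have "(\<integral>\<^sup>+\<omega>. ennreal (Y i \<omega>) \<partial>M) =
        (\<integral>\<^sup>+\<omega>. ennreal (exp (- \<kappa> * (E - \<theta> * C))) * ennreal (exp (\<kappa> * (- U i \<omega> - expectation (\<lambda>\<omega>. - U i \<omega>)))) \<partial>M)"
      by (intro nn_integral_cong)
        (simp add: Y_def E_def algebra_simps flip: ennreal_mult' exp_add)
    also have "\<dots> = ennreal (exp (- \<kappa> * (E - \<theta> * C))) *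
        (\<integral>\<^sup>+\<omega>. ennreal (exp (\<kappa> * (- U i \<omega> - expectation (\<lambda>\<omega>. - U i \<omega>)))) \<partial>M)"
      using rv[OF i] by (intro nn_integral_cmult) measurable
    also have "\<dots> \<le> ennreal (exp (- \<kappa> * (E - \<theta> * C))) * ennreal (exp (\<kappa>\<^sup>2 * A\<^sup>2 / 8))"
      using V.Hoeffdings_lemma_nn_integral[OF \<kappa>] by (intro mult_left_mono) auto
    also have "\<dots> = ennreal (exp (- \<kappa> * (E - \<theta> * C) + \<kappa>\<^sup>2 * A\<^sup>2 / 8))"
      by (simp flip: ennreal_mult' exp_add)
    also have "\<dots> \<le> ennreal 1"
    proof (rule ennreal_leI)
      have "\<kappa>\<^sup>2 * A\<^sup>2 / 8 = \<kappa> * ((1 - \<theta>) * C)"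
        using pos by (simp add: \<kappa>_def field_simps power2_eq_square)
      moreover have "\<kappa> * ((1 - \<theta>) * C) \<le> \<kappa> * (E - \<theta> * C)"
        using EC \<kappa> by (intro mult_left_mono) (auto simp: algebra_simps)
      ultimately show "exp (- \<kappa> * (E - \<theta> * C) + \<kappa>\<^sup>2 * A\<^sup>2 / 8) \<le> 1" by simp
    qed
    finally show ?thesis by simp
  qed
  have "prob {\<omega>\<in>space M. \<exists>m\<le>N. (\<Prod>i<m. Y i \<omega>) \<ge> exp (\<kappa> * h)} \<le> 1 / exp (\<kappa> * h)"
    by (rule prob_prod_reaches_le[OF indY _ leY]) (auto simp: Y_def)
  moreover have "(\<Prod>i<m. Y i \<omega>) \<ge> exp (\<kappa> * h) \<longleftrightarrow> (\<Sum>i<m. U i \<omega>) \<le> \<theta> * m * C - h" for m \<omega>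
  proof -
    have "(\<Prod>i<m. Y i \<omega>) = exp (\<kappa> * (\<theta> * m * C - (\<Sum>i<m. U i \<omega>)))"
      by (simp add: Y_def exp_sum[symmetric] sum_subtractf sum_distrib_left[symmetric] sum_negf algebra_simps)
    then have "(\<Prod>i<m. Y i \<omega>) \<ge> exp (\<kappa> * h) \<longleftrightarrow> h \<le> \<theta> * m * C - (\<Sum>i<m. U i \<omega>)"
      using \<kappa> by simp
    then show ?thesis by auto
  qed
  ultimately show ?thesis
    by (simp add: \<kappa>_def exp_minus field_simps)
qed

text \<open>The line of slope \<open>C / 2\<close> lowered by \<open>a * C / 2\<close> is
  nonnegative from time \<open>a\<close> on, so a nonpositive walk lies below it. With offset
  \<open>\<theta> * a * C\<close> the exponent is proportional to
  \<open>\<theta> * (1 - \<theta>)\<close>, which is largest at \<open>1/2\<close>.\<close>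

lemma (in prob_space) prob_walk_nonpos_le:
  fixes U :: "nat \<Rightarrow> 'a \<Rightarrow> real"
  assumes indep: "indep_vars (\<lambda>_. borel) U {..<N}"
    and range: "\<And>i \<omega>. i < N \<Longrightarrow> U i \<omega> \<in> {l..l + A}"
    and mean: "\<And>i. i < N \<Longrightarrow> expectation (U i) \<ge> C"
    and pos: "A > 0" "C > 0"
  shows "prob {\<omega>\<in>space M. \<exists>m\<in>{a..N}. (\<Sum>i<m. U i \<omega>) \<le> 0} \<le> exp (- (2 * a * C\<^sup>2 / A\<^sup>2))"
proof -
  have [measurable]: "i < N \<Longrightarrow> U i \<in> borel_measurable M" for i
    using indep by (auto simp: indep_vars_def)
  have [measurable]: "(\<lambda>\<omega>. \<Sum>i<m. U i \<omega>) \<in> borel_measurable M" if "m \<le> N" for m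
    using that by (intro borel_measurable_sum) auto
  have "prob {\<omega>\<in>space M. \<exists>m\<in>{a..N}. (\<Sum>i<m. U i \<omega>) \<le> 0} \<le>
      prob {\<omega>\<in>space M. \<exists>m\<le>N. (\<Sum>i<m. U i \<omega>) \<le> 1/2 * m * C - a * C / 2}"
  proof (rule finite_measure_mono)
    show "{\<omega>\<in>space M. \<exists>m\<in>{a..N}. (\<Sum>i<m. U i \<omega>) \<le> 0} \<subseteq>
        {\<omega>\<in>space M. \<exists>m\<le>N. (\<Sum>i<m. U i \<omega>) \<le> 1/2 * m * C - a * C / 2}"
    proof safe
      fix \<omega> m assume m: "m \<in> {a..N}" and le: "(\<Sum>i<m. U i \<omega>) \<le> 0"
      have "real a * C \<le> real m * C" using m pos by (intro mult_right_mono) auto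
      then have "(\<Sum>i<m. U i \<omega>) \<le> 1/2 * m * C - a * C / 2" using le by simp
      then show "\<exists>m\<le>N. (\<Sum>i<m. U i \<omega>) \<le> 1/2 * m * C - a * C / 2" using m by auto
    qed
  qed measurable
  also have "\<dots> \<le> exp (- (8 * (1 - 1/2) * C * (a * C / 2) / A\<^sup>2))"
    by (rule prob_walk_crosses_line_le[OF indep range mean pos]) auto
  also have "8 * (1 - 1/2) * C * (a * C / 2) = 2 * a * C\<^sup>2"
    by (simp add: power2_eq_square)
  finally show ?thesis by simp
qed

text \<open>The increment from \<open>m mod a\<close> to \<open>m\<close> is split at time \<open>a\<close>: the first piece is a walk run
  backwards from \<open>a\<close>, the second one a walk run forwards from \<open>a\<close>, and both stay above a line.\<close>

lemma (in prob_space) prob_walk_block_gap: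
  fixes U :: "nat \<Rightarrow> 'a \<Rightarrow> real"
  assumes indep: "indep_vars (\<lambda>_. borel) U {..<N}"
    and range: "\<And>i \<omega>. i < N \<Longrightarrow> U i \<omega> \<in> {l..l + A}"
    and mean: "\<And>i. i < N \<Longrightarrow> expectation (U i) \<ge> C"
    and pos: "A > 0" "C > 0" and a: "0 < a" "a \<le> N"
  shows "prob {\<omega>\<in>space M. \<exists>m\<in>{a..N}.
      (\<Sum>i<m. U i \<omega>) - (\<Sum>i<m mod a. U i \<omega>) < real (m div a) / 2 * (a * C)}
      \<le> 2 * exp (- (a * C\<^sup>2 / (4 * A\<^sup>2)))"
proof -
  have [measurable]: "i < N \<Longrightarrow> U i \<in> borel_measurable M" for i
    using indep by (auto simp: indep_vars_def)
  define S where "S = (\<lambda>m \<omega>. \<Sum>i<m. U i \<omega>)"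
  \<comment> \<open>The two pieces have total length \<open>(m div a) * a\<close>, so slope
    \<open>3/4\<close> and offset \<open>a * C / 8\<close> leave an increment above
    \<open>3/4 * (m div a) * a * C - a * C / 4\<close>. This is at least the required gap because
    \<open>m div a\<close> is at least one. Each exponent gets the constant
    \<open>8 * 1/4 * 1/8 = 1/4\<close>.\<close>
  define B where "B = {\<omega>\<in>space M. \<exists>m\<le>a. (\<Sum>i<m. U (a - 1 - i) \<omega>) \<le> 3/4 * m * C - a * C / 8}"
  define F where "F = {\<omega>\<in>space M. \<exists>m\<le>N-a. (\<Sum>i<m. U (a + i) \<omega>) \<le> 3/4 * m * C - a * C / 8}"
  have arith: "8 * (1 - 3/4) * C * (a * C / 8) / A\<^sup>2 = a * C\<^sup>2 / (4 * A\<^sup>2)"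
    by (simp add: power2_eq_square)
  have indB: "indep_vars (\<lambda>_. borel) (\<lambda>i. U (a - 1 - i)) {..<a}"
    by (rule indep_vars_inj_reindex[OF indep]) (use a in \<open>auto simp: inj_on_def\<close>)
  have indF: "indep_vars (\<lambda>_. borel) (\<lambda>i. U (a + i)) {..<N - a}"
    by (rule indep_vars_inj_reindex[OF indep]) (use a in \<open>auto simp: inj_on_def\<close>)
  have B: "prob B \<le> exp (- (a * C\<^sup>2 / (4 * A\<^sup>2)))"
    unfolding B_def arith[symmetric]
    by (rule prob_walk_crosses_line_le[OF indB, where l = l]) (use a pos in \<open>auto intro!: range[simplified] mean\<close>)
  have F: "prob F \<le> exp (- (a * C\<^sup>2 / (4 * A\<^sup>2)))"
    unfolding F_def arith[symmetric]
    by (rule prob_walk_crosses_line_le[OF indF, where l = l]) (use a pos in \<open>auto intro!: range[simplified] mean\<close>)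
  have [measurable]: "B \<in> events" "F \<in> events"
  proof -
    have [measurable]: "(\<lambda>\<omega>. \<Sum>i<m. U (a - 1 - i) \<omega>) \<in> borel_measurable M" if "m \<le> a" for m
      using that a by (intro borel_measurable_sum) auto
    show "B \<in> events" unfolding B_def by measurable
    have [measurable]: "(\<lambda>\<omega>. \<Sum>i<m. U (a + i) \<omega>) \<in> borel_measurable M" if "m \<le> N - a" for m
      using that a by (intro borel_measurable_sum) auto
    show "F \<in> events" unfolding F_def by measurable
  qed
  have backward: "(\<Sum>i<a - j. U (a - 1 - i) \<omega>) = S a \<omega> - S j \<omega>" if "j \<le> a" for j \<omega>
  proof -
    have "S a \<omega> = S j \<omega> + (\<Sum>i=j..<a. U i \<omega>)"
      using that by (simp add: S_def lessThan_atLeast0 sum.atLeastLessThan_concat)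
    also have "(\<Sum>i=j..<a. U i \<omega>) = (\<Sum>i<a - j. U (a - 1 - i) \<omega>)"
      by (rule sum.reindex_bij_witness[of _ "\<lambda>i. a - 1 - i" "\<lambda>i. a - 1 - i"]) (use that in auto)
    finally show ?thesis by simp
  qed
  have forward: "(\<Sum>i<m - a. U (a + i) \<omega>) = S m \<omega> - S a \<omega>" if "a \<le> m" for m \<omega>
  proof -
    have "S m \<omega> = S a \<omega> + (\<Sum>i=a..<m. U i \<omega>)"
      using that by (simp add: S_def lessThan_atLeast0 sum.atLeastLessThan_concat)
    also have "(\<Sum>i=a..<m. U i \<omega>) = (\<Sum>i<m - a. U (a + i) \<omega>)"
      by (rule sum.reindex_bij_witness[of _ "\<lambda>i. a + i" "\<lambda>i. i - a"]) (use that in auto)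
    finally show ?thesis by simp
  qed
  have "{\<omega>\<in>space M. \<exists>m\<in>{a..N}. S m \<omega> - S (m mod a) \<omega> < real (m div a) / 2 * (a * C)} \<subseteq> B \<union> F"
  proof (rule subsetI, rule ccontr)
    fix \<omega> assume \<omega>: "\<omega> \<in> {\<omega>\<in>space M. \<exists>m\<in>{a..N}. S m \<omega> - S (m mod a) \<omega> < real (m div a) / 2 * (a * C)}"
      and n: "\<omega> \<notin> B \<union> F"
    then obtain m where m: "a \<le> m" "m \<le> N"
      and lt: "S m \<omega> - S (m mod a) \<omega> < real (m div a) / 2 * (a * C)" by auto
    have j: "m mod a \<le> a" using a by simp
    have "S a \<omega> - S (m mod a) \<omega> > 3/4 * real (a - m mod a) * C - a * C / 8"
    proof -
      have "\<not> (\<Sum>i<a - m mod a. U (a - 1 - i) \<omega>) \<le> 3/4 * real (a - m mod a) * C - a * C / 8"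
        using n \<omega> diff_le_self[of a "m mod a"] unfolding B_def by blast
      then show ?thesis using backward[OF j, of \<omega>] by simp
    qed
    moreover have "S m \<omega> - S a \<omega> > 3/4 * real (m - a) * C - a * C / 8"
    proof -
      have "\<not> (\<Sum>i<m - a. U (a + i) \<omega>) \<le> 3/4 * real (m - a) * C - a * C / 8"
        using n \<omega> diff_le_mono[OF m(2), of a] unfolding F_def by blast
      then show ?thesis using forward[OF m(1), of \<omega>] by simp
    qed
    ultimately have "S m \<omega> - S (m mod a) \<omega> >
        3/4 * (real (a - m mod a) + real (m - a)) * C - a * C / 4"
      by (simp add: algebra_simps)
    also have "real (a - m mod a) + real (m - a) = real (m div a) * a"
    proof -
      have "m = m div a * a + m mod a" by simp
      then have "real m = real (m div a) * real a + real (m mod a)"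
        by (metis of_nat_add of_nat_mult)
      then show ?thesis using m j by (simp add: of_nat_diff)
    qed
    finally have "S m \<omega> - S (m mod a) \<omega> > 3/4 * (real (m div a) * (a * C)) - 1/4 * (a * C)"
      by (simp add: algebra_simps)
    moreover have "1 * (a * C) \<le> real (m div a) * (a * C)"
      using m a pos by (intro mult_right_mono) (auto simp: Suc_leI div_greater_zero_iff)
    ultimately show False using lt by simp
  qed
  then have "prob {\<omega>\<in>space M. \<exists>m\<in>{a..N}. S m \<omega> - S (m mod a) \<omega> < real (m div a) / 2 * (a * C)}
      \<le> prob (B \<union> F)"
    by (rule finite_measure_mono) measurable
  also have "\<dots> \<le> prob B + prob F" by (rule measure_Un_le) measurable
  also have "\<dots> \<le> 2 * exp (- (a * C\<^sup>2 / (4 * A\<^sup>2)))" using B F by simp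
  finally show ?thesis by (simp add: S_def)
qed

subsection \<open>Laplace noise\<close>

text \<open>The law of an independent pair is the product of the two laws. With
  \<open>\<omega>'\<close> as a second sample point, the integrand is the conditional probability
  given \<open>X\<close>. This freezes first a random threshold and later the whole sample.\<close>

lemma (in prob_space) indep_var_emeasure_Fubini:
  assumes indep: "indep_var S X T Y" and A: "A \<in> sets (S \<Otimes>\<^sub>M T)"
  shows "emeasure M {\<omega>\<in>space M. (X \<omega>, Y \<omega>) \<in> A} =
    (\<integral>\<^sup>+\<omega>. emeasure M {\<omega>'\<in>space M. (X \<omega>, Y \<omega>') \<in> A} \<partial>M)"
proof -
  have X [measurable]: "X \<in> measurable M S" and Y [measurable]: "Y \<in> measurable M T"
    and eq: "distr M S X \<Otimes>\<^sub>M distr M T Y = distr M (S \<Otimes>\<^sub>M T) (\<lambda>x. (X x, Y x))"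
    using indep by (auto simp: indep_var_distribution_eq)
  interpret Y: prob_space "distr M T Y" by (rule prob_space_distr) fact
  have "emeasure M {\<omega>\<in>space M. (X \<omega>, Y \<omega>) \<in> A} = emeasure (distr M (S \<Otimes>\<^sub>M T) (\<lambda>x. (X x, Y x))) A"
    using A by (subst emeasure_distr) (auto intro!: arg_cong[where f = "emeasure M"])
  also have "\<dots> = (\<integral>\<^sup>+x. emeasure (distr M T Y) (Pair x -` A) \<partial>distr M S X)"
    unfolding eq[symmetric] using A by (subst Y.emeasure_pair_measure_alt) auto
  also have "\<dots> = (\<integral>\<^sup>+\<omega>. emeasure (distr M T Y) (Pair (X \<omega>) -` A) \<partial>M)"
  proof (rule nn_integral_distr)
    have "A \<in> sets (S \<Otimes>\<^sub>M distr M T Y)"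
      using A sets_pair_measure_cong[of S S "distr M T Y" T] by simp
    then have "(\<lambda>x. emeasure (distr M T Y) (Pair x -` A)) \<in> borel_measurable S"
      by (rule Y.measurable_emeasure_Pair)
    then show "(\<lambda>x. emeasure (distr M T Y) (Pair x -` A)) \<in> borel_measurable (distr M S X)"
      by simp
  qed fact
  also have "\<dots> = (\<integral>\<^sup>+\<omega>. emeasure M {\<omega>'\<in>space M. (X \<omega>, Y \<omega>') \<in> A} \<partial>M)"
    using A by (intro nn_integral_cong, subst emeasure_distr)
      (auto intro!: arg_cong[where f = "emeasure M"] sets_Pair1)
  finally show ?thesis .
qed

lemma nn_integral_laplace_atLeast:
  assumes "b > 0" "x \<ge> 0"
  shows "(\<integral>\<^sup>+z. ennreal (laplace_density b z) * indicator {x..} z \<partial>lborel) = ennreal (exp (- x / b) / 2)"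
proof -
  have "(\<integral>\<^sup>+z. ennreal (laplace_density b z) * indicator {x..} z \<partial>lborel) =
      (\<integral>\<^sup>+z. ennreal (exp (- z / b) / (2 * b)) * indicator {x..} z \<partial>lborel)"
    using assms by (intro nn_integral_cong) (auto simp: laplace_density_def indicator_def)
  also have "\<dots> = ennreal (0 - (- exp (- x / b) / 2))"
  proof (rule nn_integral_FTC_atLeast)
    show "((\<lambda>z. - exp (- z / b) / 2) has_real_derivative exp (- z / b) / (2 * b)) (at z)" for z
      using assms by (auto intro!: derivative_eq_intros)
    have "((\<lambda>z. exp (- z / b)) \<longlongrightarrow> 0) at_top"
      using assms by real_asymp
    then have "((\<lambda>z. - exp (- z / b) / 2) \<longlongrightarrow> - 0 / 2) at_top"
      by (intro tendsto_intros) auto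
    then show "((\<lambda>z. - exp (- z / b) / 2) \<longlongrightarrow> 0) at_top" by simp
  qed (use assms in auto)
  finally show ?thesis by simp
qed

context prob_space
begin

definition laplace_rv :: "real \<Rightarrow> ('a \<Rightarrow> real) \<Rightarrow> bool" where
  "laplace_rv b Z \<longleftrightarrow> distributed M lborel Z (\<lambda>z. ennreal (laplace_density b z))"

lemma laplace_rv_measurable: "laplace_rv b Z \<Longrightarrow> Z \<in> borel_measurable M"
  by (auto simp: laplace_rv_def dest: distributed_measurable)

lemma emeasure_laplace_rv:
  assumes "laplace_rv b Z" "A \<in> sets borel"
  shows "emeasure M {\<omega>\<in>space M. Z \<omega> \<in> A} =
    (\<integral>\<^sup>+z. ennreal (laplace_density b z) * indicator A z \<partial>lborel)"
proof -
  have "{\<omega>\<in>space M. Z \<omega> \<in> A} = Z -` A \<inter> space M" by auto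
  then show ?thesis
    using distributed_emeasure[of M lborel Z _ A] assms unfolding laplace_rv_def by simp
qed

lemma prob_laplace_rv_ge:
  assumes "laplace_rv b Z" "b > 0" "x \<ge> 0"
  shows "prob {\<omega>\<in>space M. Z \<omega> \<ge> x} = exp (- x / b) / 2"
  using emeasure_laplace_rv[OF assms(1), of "{x..}"] nn_integral_laplace_atLeast[OF assms(2,3)]
  by (simp add: emeasure_eq_measure)

text \<open>The Laplace law has no atoms. Strict inequalities will make the winning events of the
  near indices disjoint, whereas the tail formula is stated for weak ones.\<close>

lemma prob_laplace_rv_gt_eq_ge:
  assumes "laplace_rv b Z"
  shows "prob {\<omega>\<in>space M. Z \<omega> > x} = prob {\<omega>\<in>space M. Z \<omega> \<ge> x}"
proof -
  have "(\<integral>\<^sup>+z. ennreal (laplace_density b z) * indicator {x<..} z \<partial>lborel) =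
      (\<integral>\<^sup>+z. ennreal (laplace_density b z) * indicator {x..} z \<partial>lborel)"
    by (intro nn_integral_cong_AE eventually_mono[OF AE_lborel_singleton[of x]])
      (auto simp: indicator_def)
  then have "emeasure M {\<omega>\<in>space M. Z \<omega> \<in> {x<..}} = emeasure M {\<omega>\<in>space M. Z \<omega> \<in> {x..}}"
    by (simp only: emeasure_laplace_rv[OF assms] lborelD_Collect borel_open borel_closed
        open_greaterThan closed_atLeast)
  then show ?thesis by (simp add: emeasure_eq_measure)
qed

lemma prob_laplace_rv_le:
  assumes "laplace_rv b Z" "b > 0" "x \<ge> 0"
  shows "prob {\<omega>\<in>space M. Z \<omega> \<le> - x} = exp (- x / b) / 2"
proof -
  have [measurable]: "laplace_density b \<in> borel_measurable borel"
    unfolding laplace_density_def by measurable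
  have "(\<integral>\<^sup>+z. ennreal (laplace_density b z) * indicator {..-x} z \<partial>lborel) =
      (\<integral>\<^sup>+z. ennreal (laplace_density b (0 + (-1) * z)) * indicator {..-x} (0 + (-1) * z) \<partial>lborel)"
    by (subst nn_integral_real_affine[where c = "-1" and t = 0]) auto
  also have "\<dots> = (\<integral>\<^sup>+z. ennreal (laplace_density b z) * indicator {x..} z \<partial>lborel)"
    by (intro nn_integral_cong) (auto simp: laplace_density_def indicator_def)
  finally show ?thesis
    using emeasure_laplace_rv[OF assms(1), of "{..-x}"] nn_integral_laplace_atLeast[OF assms(2,3)]
    by (simp add: emeasure_eq_measure)
qed

text \<open>At nonnegative levels the tail is exactly exponential, and a shift by
  \<open>b * d\<close> costs the factor \<open>exp (- d)\<close>. At a negative level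
  \<open>u\<close> the formula \<open>exp (- u / b) / 2\<close> overestimates the tail, but by at
  most the factor \<open>exp v\<close> as long as \<open>u \<ge> - (v * b)\<close>.\<close>

lemma prob_laplace_rv_shift_le:
  assumes Z: "laplace_rv b Z" "laplace_rv b Z'" and b: "b > 0"
    and vd: "0 \<le> v" "v \<le> d" and u: "u \<ge> - (v * b)"
  shows "prob {\<omega>\<in>space M. Z \<omega> \<ge> u + b * d} \<le> exp (v - d) * prob {\<omega>\<in>space M. Z' \<omega> > u}"
proof -
  have [measurable]: "Z' \<in> borel_measurable M" using Z(2) by (rule laplace_rv_measurable)
  have "u + b * d \<ge> b * (d - v)" using u by (simp add: algebra_simps)
  also have "b * (d - v) \<ge> 0" using b vd by simp
  finally have "prob {\<omega>\<in>space M. Z \<omega> \<ge> u + b * d} = exp (- (u + b * d) / b) / 2"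
    by (rule prob_laplace_rv_ge[OF Z(1) b])
  also have "\<dots> = exp (v - d) * (exp (- v - u / b) / 2)"
    using b by (simp add: field_simps flip: exp_add)
  also have "exp (- v - u / b) / 2 \<le> prob {\<omega>\<in>space M. Z' \<omega> \<ge> u}"
  proof (cases "u \<ge> 0")
    case True
    then show ?thesis using prob_laplace_rv_ge[OF Z(2) b True] vd by simp
  next
    case False
    have "- v - u / b \<le> 0" using u b by (simp add: field_simps)
    then have "exp (- v - u / b) / 2 \<le> prob {\<omega>\<in>space M. Z' \<omega> \<ge> 0}"
      using prob_laplace_rv_ge[OF Z(2) b, of 0] by simp
    also have "\<dots> \<le> prob {\<omega>\<in>space M. Z' \<omega> \<ge> u}"
      using False by (intro finite_measure_mono) auto
    finally show ?thesis .
  qed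
  finally show ?thesis
    using prob_laplace_rv_gt_eq_ge[OF Z(2)] by simp
qed

text \<open>Conditioning on the threshold \<open>W\<close>, separately in its pair with
  \<open>Z\<close> and in its pair with \<open>Z'\<close>, reduces the claim to fixed shifts, whose
  bound is then integrated.\<close>

lemma prob_laplace_rv_random_shift_le:
  assumes Z: "laplace_rv b Z" "laplace_rv b Z'" and b: "b > 0"
    and vd: "0 \<le> v" "v \<le> d" and W: "\<And>\<omega>. W \<omega> \<ge> - (v * b)"
    and indep: "indep_var borel W borel Z" "indep_var borel W borel Z'"
  shows "prob {\<omega>\<in>space M. Z \<omega> \<ge> W \<omega> + b * d} \<le> exp (v - d) * prob {\<omega>\<in>space M. Z' \<omega> > W \<omega>}"
proof -
  have [measurable]: "W \<in> borel_measurable M" "Z \<in> borel_measurable M" "Z' \<in> borel_measurable M"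
    using indep by (auto dest: indep_var_rv1 indep_var_rv2)
  define S where "S = {p :: real \<times> real. snd p \<ge> fst p + b * d}"
  define S' where "S' = {p :: real \<times> real. snd p > fst p}"
  have sets: "S \<in> sets (borel \<Otimes>\<^sub>M borel)" "S' \<in> sets (borel \<Otimes>\<^sub>M borel)"
  proof -
    have "{p \<in> space (borel \<Otimes>\<^sub>M borel :: (real \<times> real) measure). snd p \<ge> fst p + b * d} \<in> sets (borel \<Otimes>\<^sub>M borel)"
      "{p \<in> space (borel \<Otimes>\<^sub>M borel :: (real \<times> real) measure). snd p > fst p} \<in> sets (borel \<Otimes>\<^sub>M borel)"
      by measurable
    then show "S \<in> sets (borel \<Otimes>\<^sub>M borel)" "S' \<in> sets (borel \<Otimes>\<^sub>M borel)"
      by (simp_all add: S_def S'_def space_pair_measure)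
  qed
  have "ennreal (prob {\<omega>\<in>space M. Z \<omega> \<ge> W \<omega> + b * d}) =
      (\<integral>\<^sup>+\<omega>. ennreal (prob {\<omega>'\<in>space M. Z \<omega>' \<ge> W \<omega> + b * d}) \<partial>M)"
    using indep_var_emeasure_Fubini[OF indep(1) sets(1)] by (simp add: S_def emeasure_eq_measure)
  also have "\<dots> \<le> (\<integral>\<^sup>+\<omega>. ennreal (exp (v - d)) * ennreal (prob {\<omega>'\<in>space M. Z' \<omega>' > W \<omega>}) \<partial>M)"
    by (intro nn_integral_mono)
      (simp add: prob_laplace_rv_shift_le[OF Z b vd W] ennreal_leI flip: ennreal_mult')
  also have "\<dots> = ennreal (exp (v - d)) * (\<integral>\<^sup>+\<omega>. ennreal (prob {\<omega>'\<in>space M. Z' \<omega>' > W \<omega>}) \<partial>M)"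
  proof (rule nn_integral_cmult)
    interpret Z': prob_space "distr M borel Z'" by (rule prob_space_distr) simp
    \<comment> \<open>Measurability in \<open>w\<close> comes from writing the probability as the
      measure of a section of \<open>S'\<close>.\<close>
    have "(\<lambda>w. prob {\<omega>'\<in>space M. Z' \<omega>' > w}) = (\<lambda>w. measure (distr M borel Z') {w<..})"
      by (subst measure_distr) (auto simp: vimage_def intro!: ext arg_cong[where f = prob])
    moreover have "(\<lambda>w. measure (distr M borel Z') (Pair w -` S')) \<in> borel_measurable borel"
    proof -
      have "S' \<in> sets (borel \<Otimes>\<^sub>M distr M borel Z')"
        using sets(2) sets_pair_measure_cong[of borel borel "distr M borel Z'" borel] by simp
      from Z'.measurable_emeasure_Pair[OF this] show ?thesis
        by (simp add: measure_def)
    qed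
    ultimately have [measurable]: "(\<lambda>w. prob {\<omega>'\<in>space M. Z' \<omega>' > w}) \<in> borel_measurable borel"
      by (simp add: S'_def vimage_def greaterThan_def)
    show "(\<lambda>\<omega>. ennreal (prob {\<omega>'\<in>space M. Z' \<omega>' > W \<omega>})) \<in> borel_measurable M"
      by measurable
  qed
  also have "(\<integral>\<^sup>+\<omega>. ennreal (prob {\<omega>'\<in>space M. Z' \<omega>' > W \<omega>}) \<partial>M) =
      ennreal (prob {\<omega>\<in>space M. Z' \<omega> > W \<omega>})"
    using indep_var_emeasure_Fubini[OF indep(2) sets(2)] by (simp add: S'_def emeasure_eq_measure)
  finally show ?thesis
    by (simp flip: ennreal_mult')
qed

section \<open>Far indices competing with the near block\<close>

text \<open>The scores \<open>f\<close> are fixed here and only the noise is random. A far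
  \<open>k\<close> is charged to its partner \<open>g k\<close>: unless the best near index has very
  low noise, beating the near block forces \<open>Z k\<close> to exceed by \<open>b * d k\<close>
  the level at which the partner would win. That has probability at most
  \<open>exp (v - d k)\<close> times the partner's chance to win. Wins are disjoint, so the total is
  at most \<open>exp v * w\<close>; the exception costs \<open>exp (- v) / 2\<close>.\<close>

lemma prob_far_beats_near_le:
  fixes Z :: "'i \<Rightarrow> 'a \<Rightarrow> real" and f :: "'i \<Rightarrow> real"
  assumes indep: "indep_vars (\<lambda>_. borel) Z (N \<union> K)"
    and fin: "finite N" "finite K" and disj: "N \<inter> K = {}" and N: "N \<noteq> {}"
    and lap: "\<And>i. i \<in> N \<union> K \<Longrightarrow> laplace_rv b (Z i)" and b: "b > 0" and v: "v \<ge> 0"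
    and g: "\<And>k. k \<in> K \<Longrightarrow> g k \<in> N" and d: "\<And>k. k \<in> K \<Longrightarrow> v \<le> d k"
    and gap: "\<And>k. k \<in> K \<Longrightarrow> f (g k) - f k \<ge> b * d k"
    and W: "\<And>j. j \<in> N \<Longrightarrow> (\<Sum>k\<in>{k\<in>K. g k = j}. exp (- d k)) \<le> w"
  shows "prob {\<omega>\<in>space M. \<exists>k\<in>K. \<forall>j\<in>N. f k + Z k \<omega> \<ge> f j + Z j \<omega>} \<le> exp (- v) / 2 + exp v * w"
proof -
  have rv: "i \<in> N \<union> K \<Longrightarrow> Z i \<in> borel_measurable M" for i
    using lap laplace_rv_measurable by blast
  obtain j0 where j0: "j0 \<in> N" "\<And>j. j \<in> N \<Longrightarrow> f j \<le> f j0"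
  proof -
    have "Max (f ` N) \<in> f ` N" using fin N by (intro Max_in) auto
    then obtain j0 where "j0 \<in> N" "f j0 = Max (f ` N)" by auto
    then show ?thesis using fin by (intro that[of j0]) auto
  qed
  define \<tau> where "\<tau> = f j0 - v * b"
  \<comment> \<open>The best near index misses the cutoff \<open>\<tau>\<close> with probability at most \<open>exp (- v) / 2\<close>. The cutoff
    keeps \<open>L j\<close> above \<open>- v * b\<close>, where the Laplace tail is exponential up to the factor \<open>exp v\<close>.
    Leaving out \<open>j\<close> itself makes \<open>L j\<close> independent of both \<open>Z j\<close> and \<open>Z k\<close>.\<close>
  define L where "L = (\<lambda>j z. Max (insert \<tau> ((\<lambda>i. f i + z i) ` (N - {j}))) - f j)"
  have L_iff: "y \<ge> L j z \<longleftrightarrow> f j + y \<ge> \<tau> \<and> (\<forall>i\<in>N - {j}. f j + y \<ge> f i + z i)" for y j z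
    using fin by (auto simp: L_def algebra_simps Max_le_iff)
  have L_less: "y > L j z \<Longrightarrow> \<forall>i\<in>N - {j}. f j + y > f i + z i" for y j z
    using fin by (auto simp: L_def algebra_simps less_diff_eq Max_less_iff diff_less_eq)
  have L_ge: "L j z \<ge> - (v * b)" if "j \<in> N" for j z
  proof -
    have "\<tau> \<le> Max (insert \<tau> ((\<lambda>i. f i + z i) ` (N - {j})))" using fin by (intro Max_ge) auto
    then show ?thesis using j0(2)[OF that] by (simp add: L_def \<tau>_def)
  qed
  have L_restrict: "L j (\<lambda>i\<in>N - {j}. z i) = L j z" for j z
    by (simp add: L_def cong: image_cong_simp)
  have L_meas: "L j \<in> borel_measurable (PiM (N - {j}) (\<lambda>_. borel))" for j
  proof -
    \<comment> \<open>The cutoff enters as the member with index \<open>None\<close>, which makes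
      \<open>L j\<close> a maximum over a finite nonempty family of measurable functions.\<close>
    have "(\<lambda>z. Max ((\<lambda>i. case i of None \<Rightarrow> \<tau> | Some i \<Rightarrow> f i + z i) ` (insert None (Some ` (N - {j}))))) \<in>
        borel_measurable (PiM (N - {j}) (\<lambda>_. borel))"
    proof (rule borel_measurable_Max)
      fix i assume "i \<in> insert None (Some ` (N - {j}))"
      then show "(\<lambda>z. case i of None \<Rightarrow> \<tau> | Some i \<Rightarrow> f i + z i) \<in> borel_measurable (PiM (N - {j}) (\<lambda>_. borel))"
        by (cases i) (auto intro!: borel_measurable_add measurable_component_singleton)
    qed (use fin in simp)
    then show ?thesis
      unfolding L_def by (simp add: image_image)
  qed
  have L_indep: "indep_var borel (\<lambda>\<omega>. L j (\<lambda>i. Z i \<omega>)) borel (Z k)"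
    if "k \<in> N \<union> K" "k \<notin> N - {j}" for j k
  proof -
    have "indep_var (PiM (N - {j}) (\<lambda>_. borel)) (\<lambda>\<omega>. \<lambda>i\<in>N - {j}. Z i \<omega>)
        (PiM {k} (\<lambda>_. borel)) (\<lambda>\<omega>. \<lambda>i\<in>{k}. Z i \<omega>)"
      by (rule indep_var_restrict[OF indep]) (use that in auto)
    from indep_var_compose[OF this L_meas measurable_component_singleton[of k]]
    show ?thesis by (simp add: comp_def L_restrict)
  qed
  define D where "D = (\<lambda>j. {\<omega>\<in>space M. Z j \<omega> > L j (\<lambda>i. Z i \<omega>)})"
  have D_events: "D j \<in> events" if "j \<in> N" for j
  proof -
    have [measurable]: "(\<lambda>\<omega>. L j (\<lambda>i. Z i \<omega>)) \<in> borel_measurable M" "Z j \<in> borel_measurable M"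
      using L_indep[of j j] that by (auto dest: indep_var_rv1 indep_var_rv2)
    show ?thesis unfolding D_def by measurable
  qed
  have D_sum: "(\<Sum>j\<in>N. prob (D j)) \<le> 1"
  proof -
    \<comment> \<open>Two strict winners would each have a larger noisy score than the
      other.\<close>
    have "disjoint_family_on D N"
      unfolding disjoint_family_on_def
    proof (intro ballI impI)
      fix i j assume ij: "i \<in> N" "j \<in> N" "i \<noteq> j"
      show "D i \<inter> D j = {}"
      proof (rule ccontr)
        assume "D i \<inter> D j \<noteq> {}"
        then obtain \<omega> where "Z i \<omega> > L i (\<lambda>i. Z i \<omega>)" "Z j \<omega> > L j (\<lambda>i. Z i \<omega>)"
          by (auto simp: D_def)
        then have "f i + Z i \<omega> > f j + Z j \<omega>" "f j + Z j \<omega> > f i + Z i \<omega>"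
          using ij L_less by blast+
        then show False by simp
      qed
    qed
    then have "(\<Sum>j\<in>N. prob (D j)) = prob (\<Union>j\<in>N. D j)"
      using fin D_events by (intro finite_measure_finite_Union[symmetric]) auto
    then show ?thesis by simp
  qed
  define F where "F = (\<lambda>k. {\<omega>\<in>space M. Z k \<omega> \<ge> L (g k) (\<lambda>i. Z i \<omega>) + b * d k})"
  have F_events: "F k \<in> events" if "k \<in> K" for k
  proof -
    have [measurable]: "(\<lambda>\<omega>. L (g k) (\<lambda>i. Z i \<omega>)) \<in> borel_measurable M" "Z k \<in> borel_measurable M"
      using L_indep[of k "g k"] that disj by (auto dest: indep_var_rv1 indep_var_rv2)
    show ?thesis unfolding F_def by measurable
  qed
  have F_prob: "prob (F k) \<le> exp v * (exp (- d k) * prob (D (g k)))" if k: "k \<in> K" for k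
  proof -
    have "prob (F k) \<le> exp (v - d k) * prob (D (g k))"
      unfolding F_def D_def
      using k g[OF k] disj v d[OF k] L_ge[OF g[OF k]]
      by (intro prob_laplace_rv_random_shift_le lap b L_indep) auto
    then show ?thesis by (simp add: exp_diff exp_minus field_simps)
  qed
  define H where "H = {\<omega>\<in>space M. Z j0 \<omega> \<le> - (v * b)}"
  have H_events: "H \<in> events"
  proof -
    have [measurable]: "Z j0 \<in> borel_measurable M" using rv j0 by simp
    show ?thesis unfolding H_def by measurable
  qed
  have H_prob: "prob H = exp (- v) / 2"
    unfolding H_def using prob_laplace_rv_le[OF lap b, of j0 "v * b"] j0 b v by simp
  \<comment> \<open>Off \<open>H\<close> the noisy score of \<open>j0\<close> exceeds
    \<open>\<tau>\<close>, hence so does that of a far index beating it. By \<open>gap\<close> the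
    noise of this index then clears the level of its partner by \<open>b * d k\<close>.\<close>
  have "{\<omega>\<in>space M. \<exists>k\<in>K. \<forall>j\<in>N. f k + Z k \<omega> \<ge> f j + Z j \<omega>} \<subseteq> H \<union> (\<Union>k\<in>K. F k)"
  proof safe
    fix \<omega> k assume \<omega>: "\<omega> \<in> space M" and k: "k \<in> K" and beats: "\<forall>j\<in>N. f k + Z k \<omega> \<ge> f j + Z j \<omega>"
      and nF: "\<omega> \<notin> (\<Union>k\<in>K. F k)"
    show "\<omega> \<in> H"
    proof (rule ccontr)
      assume "\<omega> \<notin> H"
      then have "f k + Z k \<omega> \<ge> \<tau>" using beats j0 \<omega> by (fastforce simp: H_def \<tau>_def)
      then have "f k - f (g k) + Z k \<omega> \<ge> L (g k) (\<lambda>i. Z i \<omega>)"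
        unfolding L_iff using beats by auto
      then have "\<omega> \<in> F k" using gap[OF k] \<omega> by (auto simp: F_def)
      then show False using nF k by auto
    qed
  qed
  then have "prob {\<omega>\<in>space M. \<exists>k\<in>K. \<forall>j\<in>N. f k + Z k \<omega> \<ge> f j + Z j \<omega>} \<le> prob (H \<union> (\<Union>k\<in>K. F k))"
    using H_events F_events fin by (intro finite_measure_mono sets.Un sets.finite_UN) auto
  also have "\<dots> \<le> prob H + prob (\<Union>k\<in>K. F k)"
    using H_events F_events fin by (intro measure_Un_le sets.finite_UN) auto
  also have "prob (\<Union>k\<in>K. F k) \<le> (\<Sum>k\<in>K. prob (F k))"
    using F_events fin by (intro measure_UNION_le) auto
  also have "\<dots> \<le> (\<Sum>k\<in>K. exp v * (exp (- d k) * prob (D (g k))))"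
    by (intro sum_mono F_prob)
  \<comment> \<open>Grouping by partner makes the bound independent of the number of far indices:
    each group has weight at most \<open>w\<close>.\<close>
  also have "\<dots> = exp v * (\<Sum>j\<in>N. \<Sum>k\<in>{k\<in>K. g k = j}. exp (- d k) * prob (D (g k)))"
    using fin g by (subst sum.group) (auto simp: sum_distrib_left)
  also have "\<dots> = exp v * (\<Sum>j\<in>N. (\<Sum>k\<in>{k\<in>K. g k = j}. exp (- d k)) * prob (D j))"
    by (simp add: sum_distrib_right)
  also have "\<dots> \<le> exp v * (\<Sum>j\<in>N. w * prob (D j))"
    by (intro mult_left_mono sum_mono mult_right_mono W) auto
  also have "\<dots> \<le> exp v * w"
  proof -
    have "0 \<le> w" using W[OF j0(1)] by (meson order_trans sum_nonneg exp_ge_zero)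
    then have "w * (\<Sum>j\<in>N. prob (D j)) \<le> w * 1" using D_sum by (intro mult_left_mono)
    then show ?thesis unfolding sum_distrib_left[symmetric] by (intro mult_left_mono) simp_all
  qed
  finally show ?thesis using H_prob by simp
qed

end

section \<open>Combining the walk with the noise\<close>

text \<open>Given \<open>X\<close>, the conditional probability is bounded by one outside
  \<open>G\<close> and by \<open>c\<close> inside.\<close>

lemma (in prob_space) prob_indep_var_le:
  assumes indep: "indep_var S X T Y" and A: "A \<in> sets (S \<Otimes>\<^sub>M T)" and G: "G \<in> sets S"
    and le: "\<And>\<omega>. \<omega> \<in> space M \<Longrightarrow> X \<omega> \<in> G \<Longrightarrow> prob {\<omega>'\<in>space M. (X \<omega>, Y \<omega>') \<in> A} \<le> c"
    and c: "c \<ge> 0"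
  shows "prob {\<omega>\<in>space M. (X \<omega>, Y \<omega>) \<in> A} \<le> prob {\<omega>\<in>space M. X \<omega> \<notin> G} + c"
proof -
  have [measurable]: "X \<in> measurable M S" using indep by (rule indep_var_rv1)
  note [measurable] = G
  define B where "B = {\<omega>\<in>space M. X \<omega> \<notin> G}"
  have B [measurable]: "B \<in> events" unfolding B_def by measurable
  have "emeasure M {\<omega>\<in>space M. (X \<omega>, Y \<omega>) \<in> A} =
      (\<integral>\<^sup>+\<omega>. emeasure M {\<omega>'\<in>space M. (X \<omega>, Y \<omega>') \<in> A} \<partial>M)"
    by (rule indep_var_emeasure_Fubini[OF indep A])
  also have "\<dots> \<le> (\<integral>\<^sup>+\<omega>. indicator B \<omega> + ennreal c \<partial>M)"
  proof (rule nn_integral_mono)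
    fix \<omega> assume \<omega>: "\<omega> \<in> space M"
    show "emeasure M {\<omega>'\<in>space M. (X \<omega>, Y \<omega>') \<in> A} \<le> indicator B \<omega> + ennreal c"
    proof (cases "X \<omega> \<in> G")
      case True
      then show ?thesis using le[OF \<omega>] \<omega> by (simp add: B_def emeasure_eq_measure ennreal_leI)
    next
      case False
      then have "indicator B \<omega> = (1 :: ennreal)" using \<omega> by (simp add: B_def)
      moreover have "emeasure M {\<omega>'\<in>space M. (X \<omega>, Y \<omega>') \<in> A} \<le> 1 + ennreal c"
        using emeasure_le_1 by (meson add_increasing2 zero_le)
      ultimately show ?thesis by simp
    qed
  qed
  also have "\<dots> = emeasure M B + ennreal c"
    by (subst nn_integral_add) (auto simp: emeasure_space_1)
  finally show ?thesis
    using c by (simp add: emeasure_eq_measure B_def flip: ennreal_plus)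
qed

text \<open>With the residue fixed, \<open>k\<close> is determined by \<open>k div a\<close>, which
  is at least one because \<open>k \<ge> a\<close>. So the sum is part of a geometric series
  starting at exponent one, bounded by \<open>q / (1 - q)\<close>.\<close>

lemma sum_power_div_le:
  fixes q :: real
  assumes q: "0 \<le> q" "q \<le> 1/2" and a: "0 < a"
  shows "(\<Sum>k\<in>{k\<in>{a..N}. k mod a = j}. q ^ (k div a)) \<le> 2 * q"
proof -
  have inj: "inj_on (\<lambda>k. k div a) {k\<in>{a..N}. k mod a = j}"
    by (rule inj_onI) (metis (mono_tags, lifting) div_mult_mod_eq mem_Collect_eq)
  have "(\<Sum>k\<in>{k\<in>{a..N}. k mod a = j}. q ^ (k div a)) =
      (\<Sum>i\<in>(\<lambda>k. k div a) ` {k\<in>{a..N}. k mod a = j}. q ^ i)"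
    using inj by (simp add: sum.reindex)
  also have "\<dots> \<le> (\<Sum>i\<in>{1..<Suc N}. q ^ i)"
  proof (rule sum_mono2)
    show "(\<lambda>k. k div a) ` {k\<in>{a..N}. k mod a = j} \<subseteq> {1..<Suc N}"
      using a by (auto simp: Suc_le_eq div_greater_zero_iff less_Suc_eq_le intro: order_trans[OF div_le_dividend])
  qed (use q in auto)
  also have "\<dots> = q * (\<Sum>i<N. q ^ i)"
    using sum.shift_bounds_Suc_ivl[of "\<lambda>i. q ^ i" 0 N]
    by (simp only: One_nat_def power_Suc sum_distrib_left lessThan_atLeast0)
  also have "\<dots> \<le> q * 2"
  proof (rule mult_left_mono)
    have "(\<Sum>i<N. q ^ i) = (1 - q ^ N) / (1 - q)" using q by (subst sum_gp_strict) auto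
    also have "\<dots> \<le> 1 / (1 - q)" using q by (intro divide_right_mono) auto
    also have "\<dots> \<le> 2" using q by (simp add: field_simps)
    finally show "(\<Sum>i<N. q ^ i) \<le> 2" .
  qed (use q in simp)
  finally show ?thesis by simp
qed

text \<open>One side of the change point, with \<open>m\<close> the distance from it. A sample is
  good if every far index trails its partner by the block gap; given a good sample the scores are
  fixed and the noise comparison applies. The lower bound on \<open>a\<close> with \<open>64\<close>
  makes bad samples rare, the one with \<open>16\<close> makes the gap large against the
  noise.\<close>

lemma (in prob_space) prob_noisy_walk_far_le:
  fixes U Z :: "nat \<Rightarrow> 'a \<Rightarrow> real"
  assumes indepU: "indep_vars (\<lambda>_. borel) U {..<N}"
    and range: "\<And>i \<omega>. i < N \<Longrightarrow> U i \<omega> \<in> {l..l + A}"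
    and mean: "\<And>i. i < N \<Longrightarrow> expectation (U i) \<ge> C"
    and pos: "A > 0" "C > 0" "\<epsilon> > 0"
    and indepZ: "indep_vars (\<lambda>_. borel) Z {..N}"
    and lap: "\<And>i. i \<le> N \<Longrightarrow> laplace_rv (A / \<epsilon>) (Z i)"
    and indep: "indep_var (PiM {..<N} (\<lambda>_. borel)) (\<lambda>\<omega>. \<lambda>i\<in>{..<N}. U i \<omega>)
      (PiM {..N} (\<lambda>_. borel)) (\<lambda>\<omega>. \<lambda>i\<in>{..N}. Z i \<omega>)"
    and \<beta>: "0 < \<beta>" "\<beta> < 1"
    and a: "0 < a" "8 * A\<^sup>2 / C\<^sup>2 * ln (64 / (3 * \<beta>)) \<le> a" "4 * A / (C * \<epsilon>) * ln (16 / \<beta>) \<le> a"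
  shows "prob {\<omega>\<in>space M. \<exists>m\<in>{a..N}. \<forall>j<a. Z m \<omega> - (\<Sum>i<m. U i \<omega>) \<ge> Z j \<omega> - (\<Sum>i<j. U i \<omega>)} \<le> \<beta> / 2"
proof (cases "a \<le> N")
  case False
  then have empty: "{\<omega>\<in>space M. \<exists>m\<in>{a..N}. \<forall>j<a. Z m \<omega> - (\<Sum>i<m. U i \<omega>) \<ge> Z j \<omega> - (\<Sum>i<j. U i \<omega>)} = {}"
    by auto
  show ?thesis unfolding empty using \<beta> by simp
next
  case True
  let ?S = "PiM {..<N} (\<lambda>_. borel) :: (nat \<Rightarrow> real) measure"
  let ?T = "PiM {..N} (\<lambda>_. borel) :: (nat \<Rightarrow> real) measure"
  define G where "G = {u \<in> space ?S. \<forall>m\<in>{a..N}.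
    real (m div a) / 2 * (a * C) \<le> (\<Sum>i<m. u i) - (\<Sum>i<m mod a. u i)}"
  define E where "E = {p \<in> space (?S \<Otimes>\<^sub>M ?T). \<exists>m\<in>{a..N}. \<forall>j<a.
    snd p m - (\<Sum>i<m. fst p i) \<ge> snd p j - (\<Sum>i<j. fst p i)}"
  have G: "G \<in> sets ?S"
  proof -
    have [measurable]: "(\<lambda>u. \<Sum>i<m. u i) \<in> borel_measurable ?S" if "m \<le> N" for m
      using that by (intro borel_measurable_sum measurable_component_singleton) auto
    have [measurable]: "(\<lambda>u. \<Sum>i<m mod a. u i) \<in> borel_measurable ?S" if "m \<le> N" for m
      using that by (intro borel_measurable_sum measurable_component_singleton)
        (auto dest!: order.strict_trans2[OF _ mod_less_eq_dividend])
    show ?thesis unfolding G_def by measurable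
  qed
  have E: "E \<in> sets (?S \<Otimes>\<^sub>M ?T)"
  proof -
    have [measurable]: "(\<lambda>p. snd p m) \<in> borel_measurable (?S \<Otimes>\<^sub>M ?T)" if "m \<le> N" for m
      using that by (intro measurable_compose[OF measurable_snd measurable_component_singleton]) auto
    have [measurable]: "(\<lambda>p. \<Sum>i<m. fst p i) \<in> borel_measurable (?S \<Otimes>\<^sub>M ?T)" if "m \<le> N" for m
      using that by (intro borel_measurable_sum measurable_compose[OF measurable_fst measurable_component_singleton]) auto
    show ?thesis unfolding E_def using True by measurable
  qed
  have sp: "(\<lambda>i\<in>{..<N}. U i \<omega>) \<in> space ?S" "(\<lambda>i\<in>{..N}. Z i \<omega>) \<in> space ?T" for \<omega>
    by (auto simp: space_PiM)
  have sumU: "(\<Sum>i<m. (\<lambda>i\<in>{..<N}. U i \<omega>) i) = (\<Sum>i<m. U i \<omega>)" if "m \<le> N" for m \<omega>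
    using that by (intro sum.cong) auto
  have E_iff: "((\<lambda>i\<in>{..<N}. U i \<omega>), (\<lambda>i\<in>{..N}. Z i \<omega>')) \<in> E \<longleftrightarrow>
      (\<exists>m\<in>{a..N}. \<forall>j\<in>{..<a}. - (\<Sum>i<m. U i \<omega>) + Z m \<omega>' \<ge> - (\<Sum>i<j. U i \<omega>) + Z j \<omega>')" for \<omega> \<omega>'
    unfolding E_def using sp True by (auto simp: space_pair_measure sumU Ball_def Bex_def)
  have modN: "m mod a \<le> N" if "m \<le> N" for m
    using that by (meson mod_less_eq_dividend order_trans)
  have G_iff: "(\<lambda>i\<in>{..<N}. U i \<omega>) \<in> G \<longleftrightarrow> (\<forall>m\<in>{a..N}.
      real (m div a) / 2 * (a * C) \<le> (\<Sum>i<m. U i \<omega>) - (\<Sum>i<m mod a. U i \<omega>))" for \<omega>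
  proof -
    have "(\<Sum>i<m. (\<lambda>i\<in>{..<N}. U i \<omega>) i) - (\<Sum>i<m mod a. (\<lambda>i\<in>{..<N}. U i \<omega>) i) =
        (\<Sum>i<m. U i \<omega>) - (\<Sum>i<m mod a. U i \<omega>)" if "m \<in> {a..N}" for m
      using that by (simp only: sumU modN atLeastAtMost_iff)
    then show ?thesis
      unfolding G_def by (simp only: mem_Collect_eq sp simp_thms cong: ball_cong)
  qed
  have "prob {\<omega>\<in>space M. (\<lambda>i\<in>{..<N}. U i \<omega>) \<notin> G} \<le> 2 * exp (- (a * C\<^sup>2 / (4 * A\<^sup>2)))"
    using prob_walk_block_gap[OF indepU range mean pos(1,2) a(1) True]
    unfolding G_iff by (simp add: not_le)
  also have "\<dots> \<le> 2 * (3 * \<beta> / 64)\<^sup>2"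
  proof -
    \<comment> \<open>The exponent is twice the logarithm, so the bound is quadratic in
      \<open>\<beta>\<close>; as \<open>\<beta> < 1\<close>, it stays below
      \<open>\<beta> / 64\<close> despite the factor \<open>2\<close>.\<close>
    have "2 * ln (64 / (3 * \<beta>)) \<le> a * C\<^sup>2 / (4 * A\<^sup>2)"
      using a(2) pos by (simp add: field_simps)
    then have "exp (- (a * C\<^sup>2 / (4 * A\<^sup>2))) \<le> exp (- (2 * ln (64 / (3 * \<beta>))))" by simp
    also have "\<dots> = (3 * \<beta> / 64)\<^sup>2"
      using \<beta> by (simp add: exp_minus exp_double power_divide)
    finally show ?thesis by simp
  qed
  also have "\<dots> \<le> \<beta> / 64"
    using \<beta> by (simp add: power2_eq_square field_simps)
  finally have badG: "prob {\<omega>\<in>space M. (\<lambda>i\<in>{..<N}. U i \<omega>) \<notin> G} \<le> \<beta> / 64" .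
  define b where "b = A / \<epsilon>"
  \<comment> \<open>\<open>v\<close> makes the price of missing the cutoff
    \<open>exp (- v) / 2 = \<beta> / 4\<close>. \<open>d m\<close> is the guaranteed gap in units of
    the noise scale, and \<open>q\<close> bounds \<open>exp (- d m)\<close> when
    \<open>m div a = 1\<close>.\<close>
  define v where "v = ln (2 / \<beta>)"
  define d where "d = (\<lambda>m. real (m div a) / 2 * (a * C) / b)"
  define q where "q = (\<beta> / 16)\<^sup>2"
  have b: "b > 0" using pos by (simp add: b_def)
  have v: "v \<ge> 0" using \<beta> by (simp add: v_def)
  have q: "0 \<le> q" "q \<le> 1/2"
    using \<beta> power_mono[of "\<beta> / 16" "1/16" 2] by (auto simp: q_def power_divide)
  have unit: "2 * ln (16 / \<beta>) \<le> a * C / (2 * b)"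
    using a(3) pos by (simp add: b_def field_simps)
  have exp_d: "exp (- d m) \<le> q ^ (m div a)" for m
  proof -
    have "real (m div a) * (2 * ln (16 / \<beta>)) \<le> real (m div a) * (a * C / (2 * b))"
      by (intro mult_left_mono unit) simp
    also have "\<dots> = d m" by (simp add: d_def)
    finally have "exp (- d m) \<le> exp (real (m div a) * - (2 * ln (16 / \<beta>)))" by simp
    also have "\<dots> = exp (- (2 * ln (16 / \<beta>))) ^ (m div a)" by (rule exp_of_nat_mult)
    also have "exp (- (2 * ln (16 / \<beta>))) = q"
      using \<beta> by (simp add: exp_minus exp_double power_divide q_def)
    finally show ?thesis .
  qed
  have noise: "prob {\<omega>'\<in>space M. ((\<lambda>i\<in>{..<N}. U i \<omega>), (\<lambda>i\<in>{..N}. Z i \<omega>')) \<in> E} \<le>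
      exp (- v) / 2 + exp v * (2 * q)" if "(\<lambda>i\<in>{..<N}. U i \<omega>) \<in> G" for \<omega>
    unfolding E_iff
  proof (rule prob_far_beats_near_le[where g = "\<lambda>m. m mod a" and d = d and b = b])
    show "indep_vars (\<lambda>_. borel) Z ({..<a} \<union> {a..N})"
      by (rule indep_vars_subset[OF indepZ]) (use True in auto)
    show "laplace_rv b (Z i)" if "i \<in> {..<a} \<union> {a..N}" for i
      unfolding b_def by (rule lap) (use that True in auto)
    show "v \<le> d m" if m: "m \<in> {a..N}" for m
    proof -
      have "ln (2 / \<beta>) \<le> ln (16 / \<beta>)" using \<beta> by (simp add: field_simps)
      moreover have "0 \<le> ln (16 / \<beta>)" using \<beta> by simp
      ultimately have "v \<le> 2 * ln (16 / \<beta>)" unfolding v_def by linarith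
      also note unit
      also have "1 * (a * C / (2 * b)) \<le> real (m div a) * (a * C / (2 * b))"
        using m a b pos by (intro mult_right_mono) (auto simp: Suc_leI div_greater_zero_iff)
      finally show ?thesis by (simp add: d_def)
    qed
    show "b * d m \<le> - (\<Sum>i<m mod a. U i \<omega>) - - (\<Sum>i<m. U i \<omega>)" if "m \<in> {a..N}" for m
      using \<open>(\<lambda>i\<in>{..<N}. U i \<omega>) \<in> G\<close> that b unfolding G_iff by (auto simp: d_def)
    show "(\<Sum>k\<in>{k\<in>{a..N}. k mod a = j}. exp (- d k)) \<le> 2 * q" if "j \<in> {..<a}" for j
      using sum_mono[OF exp_d] sum_power_div_le[OF q a(1)] by (rule order_trans)
  qed (use a b v in auto)
  have "prob {\<omega>\<in>space M. ((\<lambda>i\<in>{..<N}. U i \<omega>), (\<lambda>i\<in>{..N}. Z i \<omega>)) \<in> E} \<le>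
      prob {\<omega>\<in>space M. (\<lambda>i\<in>{..<N}. U i \<omega>) \<notin> G} + (exp (- v) / 2 + exp v * (2 * q))"
    by (rule prob_indep_var_le[OF indep E G noise]) (use q in auto)
  also have "\<dots> \<le> \<beta> / 64 + (exp (- v) / 2 + exp v * (2 * q))" using badG by simp
  also have "exp v = 2 / \<beta>" using \<beta> by (simp add: v_def)
  also have "exp (- v) = \<beta> / 2" using \<beta> by (simp add: v_def exp_minus)
  \<comment> \<open>The budget: \<open>\<beta> / 64\<close> for bad samples,
    \<open>\<beta> / 4\<close> for the cutoff, and \<open>\<beta> / 64\<close> for the far
    indices.\<close>
  also have "\<beta> / 64 + (\<beta> / 2 / 2 + 2 / \<beta> * (2 * q)) \<le> \<beta> / 2"
    using \<beta> by (simp add: q_def power2_eq_square field_simps)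
  finally show ?thesis
    unfolding E_iff by (simp add: algebra_simps Ball_def)
qed

text \<open>Both families are measurable images of the given blocks. This passes from sample and
  noise indexed by time to walk steps and noise indexed by distance from the change point.\<close>

lemma (in prob_space) indep_var_reindex_compose:
  fixes X Z :: "'i \<Rightarrow> 'a \<Rightarrow> real" and h :: "real \<Rightarrow> real"
  assumes indep: "indep_var (PiM I (\<lambda>_. borel)) (\<lambda>\<omega>. \<lambda>i\<in>I. X i \<omega>)
      (PiM I (\<lambda>_. borel)) (\<lambda>\<omega>. \<lambda>i\<in>I. Z i \<omega>)"
    and \<pi>: "\<And>j. j \<in> J \<Longrightarrow> \<pi> j \<in> I" and \<rho>: "\<And>j. j \<in> J' \<Longrightarrow> \<rho> j \<in> I"
    and h: "h \<in> borel_measurable borel"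
  shows "indep_var (PiM J (\<lambda>_. borel)) (\<lambda>\<omega>. \<lambda>j\<in>J. h (X (\<pi> j) \<omega>))
      (PiM J' (\<lambda>_. borel)) (\<lambda>\<omega>. \<lambda>j\<in>J'. Z (\<rho> j) \<omega>)"
proof -
  have "(\<lambda>x. \<lambda>j\<in>J. h (x (\<pi> j))) \<in> measurable (PiM I (\<lambda>_. borel)) (PiM J (\<lambda>_. borel))"
    using \<pi> by (intro measurable_restrict measurable_compose[OF _ h] measurable_component_singleton)
  moreover have "(\<lambda>x. \<lambda>j\<in>J'. x (\<rho> j)) \<in> measurable (PiM I (\<lambda>_. borel)) (PiM J' (\<lambda>_. borel :: real measure))"
    using \<rho> by (intro measurable_restrict measurable_component_singleton)
  ultimately have "indep_var (PiM J (\<lambda>_. borel)) ((\<lambda>x. \<lambda>j\<in>J. h (x (\<pi> j))) \<circ> (\<lambda>\<omega>. \<lambda>i\<in>I. X i \<omega>))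
      (PiM J' (\<lambda>_. borel)) ((\<lambda>x. \<lambda>j\<in>J'. x (\<rho> j)) \<circ> (\<lambda>\<omega>. \<lambda>i\<in>I. Z i \<omega>))"
    by (rule indep_var_compose[OF indep])
  then show ?thesis
    using \<pi> \<rho> by (simp add: comp_def cong: restrict_cong)
qed

subsection \<open>Log-likelihood ratios\<close>

text \<open>Since \<open>p\<close> and \<open>q\<close> have the same zeros, \<open>p / q\<close> is
  a density of the first law with respect to the second. The bound on its logarithm yields the
  integrability that strict positivity for distinct laws rests on.\<close>

lemma
  fixes p q :: "real \<Rightarrow> real"
  assumes \<mu>: "sets \<mu> = sets borel"
    and p: "p \<in> borel_measurable borel" "\<And>x. p x \<ge> 0"
    and q: "q \<in> borel_measurable borel" "\<And>x. q x \<ge> 0"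
    and zero: "\<And>x. p x = 0 \<longleftrightarrow> q x = 0" and bounded: "\<And>x. \<bar>ln (p x / q x)\<bar> \<le> B"
    and P: "prob_space (density \<mu> (\<lambda>x. ennreal (p x)))" and Q: "prob_space (density \<mu> (\<lambda>x. ennreal (q x)))"
  shows D_KL_density: "D_KL (density \<mu> (\<lambda>x. ennreal (p x))) (density \<mu> (\<lambda>x. ennreal (q x))) =
      (\<integral>x. ln (p x / q x) \<partial>density \<mu> (\<lambda>x. ennreal (p x)))" (is "D_KL ?P ?Q = _")
    and D_KL_density_pos: "density \<mu> (\<lambda>x. ennreal (p x)) \<noteq> density \<mu> (\<lambda>x. ennreal (q x)) \<Longrightarrow>
      D_KL (density \<mu> (\<lambda>x. ennreal (p x))) (density \<mu> (\<lambda>x. ennreal (q x))) > 0"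
proof -
  define r where "r = (\<lambda>x. p x / q x)"
  note [measurable] = p(1) q(1)
  have pm [measurable]: "p \<in> borel_measurable \<mu>" and qm [measurable]: "q \<in> borel_measurable \<mu>"
    using p(1) q(1) by (simp_all only: measurable_cong_sets[OF \<mu> refl])
  interpret Q: information_space ?Q "exp 1"
    by (intro information_space.intro information_space_axioms.intro Q) simp
  interpret P: prob_space ?P by (rule P)
  have r: "r \<in> borel_measurable ?Q" and r': "r \<in> borel_measurable \<mu>"
    unfolding r_def by measurable
  have r_nn: "r x \<ge> 0" for x using p q by (simp add: r_def)
  have PQ: "density ?Q (\<lambda>x. ennreal (r x)) = ?P"
  proof -
    have "density ?Q (\<lambda>x. ennreal (r x)) = density \<mu> (\<lambda>x. ennreal (q x) * ennreal (r x))"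
      using r' by (intro density_density_eq) auto
    \<comment> \<open>Where \<open>q\<close> vanishes, so does \<open>p\<close>, and the identity
      holds pointwise.\<close>
    also have "(\<lambda>x. ennreal (q x) * ennreal (r x)) = (\<lambda>x. ennreal (p x))"
      using zero q p by (auto simp: r_def fun_eq_iff simp flip: ennreal_mult')
    finally show ?thesis .
  qed
  have log: "log (exp 1) x = ln x" for x :: real by (simp add: log_def)
  have ln_r: "(\<lambda>x. ln (r x)) \<in> borel_measurable ?Q" using r by measurable
  have KL: "D_KL ?P ?Q = KL_divergence (exp 1) ?Q (density ?Q (\<lambda>x. ennreal (r x)))"
    by (simp add: D_KL_def PQ)
  also have "\<dots> = (\<integral>x. r x * log (exp 1) (r x) \<partial>?Q)"
    by (rule Q.KL_density) (use r r_nn in auto)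
  also have "\<dots> = (\<integral>x. ln (r x) \<partial>?P)"
    unfolding log PQ[symmetric] by (rule integral_real_density[symmetric]) (use r ln_r r_nn in auto)
  finally show "D_KL ?P ?Q = (\<integral>x. ln (p x / q x) \<partial>?P)" by (simp add: r_def)
  assume "?P \<noteq> ?Q"
  have "(\<lambda>x. ln (r x)) \<in> borel_measurable ?P" using r' by simp
  then have "integrable ?P (\<lambda>x. ln (r x))"
    using bounded by (intro P.integrable_const_bound[of _ B]) (auto simp: r_def)
  then have "integrable ?Q (\<lambda>x. r x * log (exp 1) (r x))"
    unfolding PQ[symmetric] log using integrable_real_density[OF r _ ln_r] r_nn by simp
  then show "D_KL ?P ?Q > 0"
    unfolding KL using \<open>?P \<noteq> ?Q\<close> r r_nn P by (intro Q.KL_gt_0) (auto simp: PQ)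
qed

lemma sensitivity_finite:
  assumes nonneg: "\<And>x. p0 x \<ge> 0" "\<And>x. p1 x \<ge> 0" and fin: "sensitivity p0 p1 < \<infinity>"
  obtains l where
    "\<And>x. real_of_ereal (log_ratio p1 p0 x) \<in> {l..l + real_of_ereal (sensitivity p0 p1)}"
    "\<And>x. p0 x = 0 \<longleftrightarrow> p1 x = 0"
    "\<And>x. real_of_ereal (log_ratio p1 p0 x) = ln (p1 x / p0 x)"
proof -
  define s where "s = (SUP x. log_ratio p1 p0 x)"
  define i where "i = (INF x. log_ratio p1 p0 x)"
  have bounds: "i \<le> log_ratio p1 p0 x" "log_ratio p1 p0 x \<le> s" for x
    by (auto simp: s_def i_def intro: SUP_upper INF_lower)
  have si: "sensitivity p0 p1 = s - i" by (simp add: sensitivity_def s_def i_def)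
  \<comment> \<open>In the extended reals \<open>\<infinity> - \<infinity>\<close> and
    \<open>-\<infinity> - (-\<infinity>)\<close> are both \<open>\<infinity>\<close>, so a
    difference below \<open>\<infinity>\<close> excludes these values.\<close>
  have "s \<noteq> \<infinity>" "i \<noteq> - \<infinity>" using fin si by (auto; cases s; cases i; auto)+
  moreover have "s \<noteq> - \<infinity>" "i \<noteq> \<infinity>"
    using bounds[of 0] calculation by (auto simp: ereal_infty_less_eq2)
  ultimately obtain s' i' where s': "s = ereal s'" and i': "i = ereal i'"
    by (cases s; cases i) auto
  have A: "real_of_ereal (sensitivity p0 p1) = s' - i'" by (simp add: si s' i')
  have fin': "log_ratio p1 p0 x \<noteq> \<infinity>" "log_ratio p1 p0 x \<noteq> - \<infinity>" for x
    using bounds[of x] s' i' by auto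
  show ?thesis
  proof
    show "real_of_ereal (log_ratio p1 p0 x) \<in> {i'..i' + real_of_ereal (sensitivity p0 p1)}" for x
      using bounds[of x] fin'[of x] unfolding A s' i' by (cases "log_ratio p1 p0 x") auto
    show zero: "p0 x = 0 \<longleftrightarrow> p1 x = 0" for x
      using fin'[of x] by (auto simp: log_ratio_def split: if_splits)
    \<comment> \<open>At a common zero the right side is \<open>ln 0 = 0\<close>, in agreement with
      the convention.\<close>
    show "real_of_ereal (log_ratio p1 p0 x) = ln (p1 x / p0 x)" for x
      using zero[of x] by (auto simp: log_ratio_def)
  qed
qed

subsection \<open>Accuracy of the estimators\<close>

theorem theorem5:
  fixes \<mu> P0 P1 :: "real measure"
    and p0 p1 :: "real \<Rightarrow> real"
    and \<Omega> :: "'w measure"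
    and X :: "nat \<Rightarrow> 'w \<Rightarrow> real"
    and n kstar :: nat
    and A C :: real
  assumes "sets \<mu> = sets borel"
    and "p0 \<in> borel_measurable borel" and "\<And>x. p0 x \<ge> 0"
    and "p1 \<in> borel_measurable borel" and "\<And>x. p1 x \<ge> 0"
    and "P0 = density \<mu> (\<lambda>x. ennreal (p0 x))" and "prob_space P0"
    and "P1 = density \<mu> (\<lambda>x. ennreal (p1 x))" and "prob_space P1"
    and "P0 \<noteq> P1"
    and "sensitivity p0 p1 < \<infinity>"
    and "A = real_of_ereal (sensitivity p0 p1)"
    and "C = min (D_KL P1 P0) (D_KL P0 P1)"
    and "1 < kstar" and "kstar \<le> n"
    and "prob_space \<Omega>"
    and "drawn_with_change \<Omega> P0 P1 n kstar X"
  shows "(\<forall>khat. is_MLE \<Omega> p0 p1 n X khat \<longrightarrow>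
            (\<forall>\<beta>>0. accurate \<Omega> kstar (2 * A\<^sup>2 / C\<^sup>2 * ln (32 / (3 * \<beta>))) \<beta> khat)) \<and>
         (\<forall>\<epsilon>>0. \<forall>ktilde. is_OfflinePCPD \<Omega> p0 p1 \<epsilon> n X ktilde \<longrightarrow>
            (\<forall>\<beta>>0. accurate \<Omega> kstar
               (max (8 * A\<^sup>2 / C\<^sup>2 * ln (64 / (3 * \<beta>))) (4 * A / (C * \<epsilon>) * ln (16 / \<beta>))) \<beta> ktilde))"
proof -
  interpret prob_space \<Omega> by fact
  note \<mu> = assms(1) and P0 = assms(6) and P1 = assms(8) and ks = assms(14,15)
  obtain l where Lr: "\<And>x. real_of_ereal (log_ratio p1 p0 x) \<in> {l..l + A}"
    and zero: "\<And>x. p0 x = 0 \<longleftrightarrow> p1 x = 0"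
    and Ln: "\<And>x. real_of_ereal (log_ratio p1 p0 x) = ln (p1 x / p0 x)"
    using sensitivity_finite[OF assms(3,5,11), folded assms(12)] by blast
  define L where "L = (\<lambda>x. real_of_ereal (log_ratio p1 p0 x))"
  have L_ln: "L x = ln (p1 x / p0 x)" for x by (simp add: L_def Ln)
  have L_swap: "ln (p0 x / p1 x) = - L x" for x
    using zero[of x] assms(3,5)[of x] by (cases "p0 x = 0") (auto simp: L_ln ln_div)
  have L_range: "L x \<in> {l..l + A}" for x using Lr by (simp add: L_def)
  have L_bd: "\<bar>L x\<bar> \<le> \<bar>l\<bar> + \<bar>l + A\<bar>" for x using L_range[of x] by auto
  have L_m [measurable]: "L \<in> borel_measurable borel"
    unfolding L_ln[abs_def] using assms(2,4) by measurable
  have s01: "sets P0 = sets borel" "sets P1 = sets borel" using \<mu> by (auto simp: P0 P1)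
  have D1: "D_KL P1 P0 = (\<integral>x. L x \<partial>P1)" "D_KL P1 P0 > 0"
  proof -
    have bd: "\<bar>ln (p1 x / p0 x)\<bar> \<le> \<bar>l\<bar> + \<bar>l + A\<bar>" for x using L_bd by (simp add: L_ln)
    note * = assms(1,4,5,2,3) zero[symmetric] bd assms(9)[unfolded P1] assms(7)[unfolded P0]
    show "D_KL P1 P0 = (\<integral>x. L x \<partial>P1)" using D_KL_density[OF *] by (simp add: P0 P1 L_ln)
    show "D_KL P1 P0 > 0" using D_KL_density_pos[OF *] assms(10) by (simp add: P0 P1)
  qed
  have D0: "D_KL P0 P1 = (\<integral>x. - L x \<partial>P0)" "D_KL P0 P1 > 0"
  proof -
    have bd: "\<bar>ln (p0 x / p1 x)\<bar> \<le> \<bar>l\<bar> + \<bar>l + A\<bar>" for x using L_bd by (simp add: L_swap)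
    note * = assms(1,2,3,4,5) zero bd assms(7)[unfolded P0] assms(9)[unfolded P1]
    show "D_KL P0 P1 = (\<integral>x. - L x \<partial>P0)" using D_KL_density[OF *] by (simp add: P0 P1 L_swap)
    show "D_KL P0 P1 > 0" using D_KL_density_pos[OF *] assms(10) by (simp add: P0 P1)
  qed
  have C: "C > 0" "D_KL P1 P0 \<ge> C" "D_KL P0 P1 \<ge> C" using D0 D1 assms(13) by auto
  \<comment> \<open>The mean of \<open>L\<close> is negative under \<open>P0\<close> and positive
    under \<open>P1\<close>, and both means lie between \<open>l\<close> and
    \<open>l + A\<close>.\<close>
  have A: "A > 0"
  proof -
    have *: "L \<in> borel_measurable P0" "L \<in> borel_measurable P1"
      by (simp_all add: measurable_cong_sets[OF s01(1) refl] measurable_cong_sets[OF s01(2) refl])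
    interpret P0: prob_space P0 by fact
    interpret P1: prob_space P1 by fact
    have "integrable P0 L" "integrable P1 L"
      using * L_bd by (auto intro!: P0.integrable_const_bound[of _ "\<bar>l\<bar> + \<bar>l + A\<bar>"]
          P1.integrable_const_bound[of _ "\<bar>l\<bar> + \<bar>l + A\<bar>"])
    then have "l \<le> (\<integral>x. L x \<partial>P0)" "(\<integral>x. L x \<partial>P1) \<le> l + A"
      using L_range by (auto intro!: P0.integral_ge_const P1.integral_le_const)
    then show ?thesis using D0 D1 by simp
  qed
  have indepX: "indep_vars (\<lambda>_. borel) X {1..n}"
    and distrX: "\<And>i. i \<in> {1..n} \<Longrightarrow> distr \<Omega> borel (X i) = (if i < kstar then P0 else P1)"
    using assms(17) by (auto simp: drawn_with_change_def)
  have X_m [measurable]: "i \<in> {1..n} \<Longrightarrow> X i \<in> borel_measurable \<Omega>" for i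
    using indepX by (auto simp: indep_vars_def)
  have E_L: "expectation (\<lambda>\<omega>. h (X i \<omega>)) = (\<integral>x. h x \<partial>(if i < kstar then P0 else P1))"
    if "i \<in> {1..n}" "h \<in> borel_measurable borel" for i and h :: "real \<Rightarrow> real"
    unfolding distrX[OF that(1), symmetric] using that by (intro integral_distr[symmetric]) auto
  have indep_walk: "indep_vars (\<lambda>_. borel) (\<lambda>i \<omega>. h (X (\<pi> i) \<omega>)) {..<N}"
    if "inj_on \<pi> {..<N}" "\<pi> ` {..<N} \<subseteq> {1..n}" "h \<in> borel_measurable borel"
    for \<pi> N and h :: "real \<Rightarrow> real"
    by (rule indep_vars_compose2[OF indep_vars_inj_reindex[OF indepX that(1,2)]]) (rule that)

  \<comment> \<open>\<open>?R\<close> uses the observations from \<open>kstar\<close> up to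
    \<open>n - 1\<close>, all from \<open>P1\<close>; \<open>?Q\<close> uses those from
    \<open>kstar - 1\<close> down to \<open>1\<close>, all from \<open>P0\<close>. The observation
    at \<open>n\<close> enters the log-likelihood of every candidate and cancels.\<close>
  let ?R = "\<lambda>i \<omega>. L (X (kstar + i) \<omega>)"
  let ?Q = "\<lambda>i \<omega>. - L (X (kstar - 1 - i) \<omega>)"
  have indR: "indep_vars (\<lambda>_. borel) ?R {..<n - kstar}"
    by (rule indep_walk) (use ks in auto)
  have indQ: "indep_vars (\<lambda>_. borel) ?Q {..<kstar - 1}"
    by (rule indep_walk[of _ _ "\<lambda>x. - L x"]) (use ks in \<open>auto simp: inj_on_def\<close>)
  have rangeR: "?R i \<omega> \<in> {l..l + A}" for i \<omega> by (rule L_range)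
  have rangeQ: "?Q i \<omega> \<in> {- (l + A)..- (l + A) + A}" for i \<omega>
    using L_range[of "X (kstar - 1 - i) \<omega>"] by auto
  have meanR: "expectation (?R i) \<ge> C" if "i < n - kstar" for i
    using E_L[of "kstar + i" L] that ks C D1 by simp
  have meanQ: "expectation (?Q i) \<ge> C" if "i < kstar - 1" for i
  proof -
    have "kstar - 1 - i \<in> {1..n}" using that ks by auto
    from E_L[OF this, of "\<lambda>x. - L x"] show ?thesis using that ks C D0 by simp
  qed
  define \<Lambda> where "\<Lambda> = (\<lambda>\<omega>. loglik p0 p1 n (\<lambda>i. X i \<omega>))"
  have \<Lambda>_right: "\<Lambda> \<omega> (kstar + m) = \<Lambda> \<omega> kstar - (\<Sum>i<m. ?R i \<omega>)" if "m \<le> n - kstar" for \<omega> m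
    using that
  proof (induction m)
    case (Suc m)
    then have "\<Lambda> \<omega> (kstar + m) = ?R m \<omega> + \<Lambda> \<omega> (kstar + Suc m)"
      by (simp add: \<Lambda>_def loglik_def L_def sum.atLeast_Suc_atMost)
    with Suc show ?case by simp
  qed simp
  have \<Lambda>_left: "\<Lambda> \<omega> (kstar - m) = \<Lambda> \<omega> kstar - (\<Sum>i<m. ?Q i \<omega>)" if "m \<le> kstar - 1" for \<omega> m
    using that
  proof (induction m)
    case (Suc m)
    then have "Suc (kstar - Suc m) = kstar - m" by simp
    then have "\<Lambda> \<omega> (kstar - Suc m) = L (X (kstar - Suc m) \<omega>) + \<Lambda> \<omega> (kstar - m)"
      using Suc.prems ks by (simp add: \<Lambda>_def loglik_def L_def sum.atLeast_Suc_atMost)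
    with Suc show ?case by simp
  qed simp

  \<comment> \<open>The distance to \<open>kstar\<close> is an integer, so an error of at least
    \<open>\<alpha>\<close> is one of at least \<open>a\<close>. Each side of the change point
    receives half of \<open>\<beta>\<close>.\<close>
  have accurateI: "accurate \<Omega> kstar \<alpha> \<beta> k"
    if k: "k \<in> measurable \<Omega> (count_space UNIV)" "\<And>\<omega>. \<omega> \<in> space \<Omega> \<Longrightarrow> k \<omega> \<in> {1..n}"
      and a: "a = nat \<lceil>\<alpha>\<rceil>"
      and B: "B \<in> events" "prob B \<le> \<beta> / 2" and F: "F \<in> events" "prob F \<le> \<beta> / 2"
      and BF: "\<And>\<omega> m. \<omega> \<in> space \<Omega> \<Longrightarrow> k \<omega> = kstar + m \<Longrightarrow> m \<in> {a..n - kstar} \<Longrightarrow> \<omega> \<in> F"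
        "\<And>\<omega> m. \<omega> \<in> space \<Omega> \<Longrightarrow> k \<omega> = kstar - m \<Longrightarrow> m \<in> {a..kstar - 1} \<Longrightarrow> \<omega> \<in> B"
    for \<alpha> \<beta> k a B F
  proof -
    have "space \<Omega> - (B \<union> F) \<subseteq> {\<omega>\<in>space \<Omega>. \<bar>real (k \<omega>) - real kstar\<bar> < \<alpha>}"
    proof safe
      fix \<omega> assume \<omega>: "\<omega> \<in> space \<Omega>" "\<omega> \<notin> B" "\<omega> \<notin> F"
      show "\<bar>real (k \<omega>) - real kstar\<bar> < \<alpha>"
      proof (rule ccontr)
        assume far: "\<not> \<bar>real (k \<omega>) - real kstar\<bar> < \<alpha>"
        show False
        proof (cases "kstar \<le> k \<omega>")
          case True
          then have "a \<le> k \<omega> - kstar" unfolding a using far by (simp add: nat_le_iff ceiling_le_iff of_nat_diff)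
          then show False using BF(1)[of \<omega> "k \<omega> - kstar"] \<omega> k(2)[of \<omega>] True
            by (auto simp: diff_le_mono)
        next
          case False
          then have "a \<le> kstar - k \<omega>" unfolding a using far by (simp add: nat_le_iff ceiling_le_iff of_nat_diff)
          then show False using BF(2)[of \<omega> "kstar - k \<omega>"] \<omega> k(2)[of \<omega>] False
            by (auto simp: diff_le_mono2)
        qed
      qed
    qed
    then have "prob (space \<Omega> - (B \<union> F)) \<le> prob {\<omega>\<in>space \<Omega>. \<bar>real (k \<omega>) - real kstar\<bar> < \<alpha>}"
      by (rule finite_measure_mono) (use k(1) in measurable)
    moreover have "prob (B \<union> F) \<le> prob B + prob F" using B F by (intro measure_Un_le) auto
    moreover have "prob (space \<Omega> - (B \<union> F)) = 1 - prob (B \<union> F)" using B F by (intro prob_compl) auto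
    ultimately show ?thesis using B F by (simp add: accurate_def)
  qed
  have accurate_trivial: "accurate \<Omega> kstar \<alpha> \<beta> k" if "\<beta> \<ge> 1" for \<alpha> \<beta> k
    using that unfolding accurate_def by (intro order_trans[OF _ measure_nonneg]) simp
  have [measurable]: "(\<lambda>\<omega>. \<Sum>i<m. ?R i \<omega>) \<in> borel_measurable \<Omega>" if "m \<le> n - kstar" for m
    using that ks by (intro borel_measurable_sum measurable_compose[OF X_m L_m]) auto
  have [measurable]: "(\<lambda>\<omega>. \<Sum>i<m. ?Q i \<omega>) \<in> borel_measurable \<Omega>" if "m \<le> kstar - 1" for m
    using that ks by (intro borel_measurable_sum borel_measurable_uminus measurable_compose[OF X_m L_m]) auto

  have "accurate \<Omega> kstar (2 * A\<^sup>2 / C\<^sup>2 * ln (32 / (3 * \<beta>))) \<beta> khat"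
    if mle: "is_MLE \<Omega> p0 p1 n X khat" and \<beta>: "\<beta> > 0" for khat \<beta>
  proof (cases "\<beta> < 1")
    case False
    then show ?thesis by (intro accurate_trivial) simp
  next
    case True
    define a where "a = nat \<lceil>2 * A\<^sup>2 / C\<^sup>2 * ln (32 / (3 * \<beta>))\<rceil>"
    have "2 * A\<^sup>2 / C\<^sup>2 * ln (32 / (3 * \<beta>)) \<le> a" unfolding a_def by linarith
    \<comment> \<open>The exponent is at least four times the logarithm, which gives the fourth
      power of \<open>3 * \<beta> / 32\<close>; as this base is below one, its first power is
      already a sufficient bound.\<close>
    then have "4 * ln (32 / (3 * \<beta>)) \<le> 2 * a * C\<^sup>2 / A\<^sup>2" using A C by (simp add: field_simps)
    then have "exp (- (2 * a * C\<^sup>2 / A\<^sup>2)) \<le> exp (- (4 * ln (32 / (3 * \<beta>))))" by simp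
    also have "\<dots> = exp (- ln (32 / (3 * \<beta>))) ^ 4"
      using exp_of_nat_mult[of 4 "- ln (32 / (3 * \<beta>))"] by simp
    also have "\<dots> = (3 * \<beta> / 32) ^ 4" using \<beta> by (simp add: exp_minus)
    also have "\<dots> \<le> (3 * \<beta> / 32) ^ 1" using \<beta> True by (intro power_decreasing) auto
    also have "\<dots> \<le> \<beta> / 2" using \<beta> by simp
    finally have bound: "exp (- (2 * a * C\<^sup>2 / A\<^sup>2)) \<le> \<beta> / 2" .
    have khat: "khat \<in> measurable \<Omega> (count_space UNIV)"
      "\<And>\<omega>. \<omega> \<in> space \<Omega> \<Longrightarrow> khat \<omega> \<in> {1..n}"
      and max: "\<And>\<omega> k. \<omega> \<in> space \<Omega> \<Longrightarrow> k \<in> {1..n} \<Longrightarrow> \<Lambda> \<omega> k \<le> \<Lambda> \<omega> (khat \<omega>)"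
      using mle by (auto simp: is_MLE_def is_arg_max_linorder \<Lambda>_def)
    show ?thesis
    proof (rule accurateI[OF khat a_def])
      show "prob {\<omega>\<in>space \<Omega>. \<exists>m\<in>{a..kstar - 1}. (\<Sum>i<m. ?Q i \<omega>) \<le> 0} \<le> \<beta> / 2"
        by (rule order_trans[OF prob_walk_nonpos_le[OF indQ rangeQ meanQ A C(1)]])
          (use bound in simp_all)
      show "prob {\<omega>\<in>space \<Omega>. \<exists>m\<in>{a..n - kstar}. (\<Sum>i<m. ?R i \<omega>) \<le> 0} \<le> \<beta> / 2"
        by (rule order_trans[OF prob_walk_nonpos_le[OF indR rangeR meanR A C(1)]])
          (use bound in simp_all)
      show "{\<omega>\<in>space \<Omega>. \<exists>m\<in>{a..n - kstar}. (\<Sum>i<m. ?R i \<omega>) \<le> 0} \<in> events"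
        "{\<omega>\<in>space \<Omega>. \<exists>m\<in>{a..kstar - 1}. (\<Sum>i<m. ?Q i \<omega>) \<le> 0} \<in> events"
        by measurable
      \<comment> \<open>A far maximiser has at least the log-likelihood of \<open>kstar\<close>, so
        the walk is nonpositive at its distance.\<close>
      show "\<omega> \<in> {\<omega>\<in>space \<Omega>. \<exists>m\<in>{a..n - kstar}. (\<Sum>i<m. ?R i \<omega>) \<le> 0}"
        if "\<omega> \<in> space \<Omega>" "khat \<omega> = kstar + m" "m \<in> {a..n - kstar}" for \<omega> m
        using that max[of \<omega> kstar] \<Lambda>_right[of m \<omega>] ks by auto
      show "\<omega> \<in> {\<omega>\<in>space \<Omega>. \<exists>m\<in>{a..kstar - 1}. (\<Sum>i<m. ?Q i \<omega>) \<le> 0}"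
        if "\<omega> \<in> space \<Omega>" "khat \<omega> = kstar - m" "m \<in> {a..kstar - 1}" for \<omega> m
      proof -
        have "(\<Sum>i<m. ?Q i \<omega>) \<le> 0"
          using that max[of \<omega> kstar] \<Lambda>_left[of m \<omega>] ks by simp
        then show ?thesis using that by blast
      qed
    qed
  qed
  moreover have "accurate \<Omega> kstar
      (max (8 * A\<^sup>2 / C\<^sup>2 * ln (64 / (3 * \<beta>))) (4 * A / (C * \<epsilon>) * ln (16 / \<beta>))) \<beta> ktilde"
    if \<epsilon>: "\<epsilon> > 0" and pcpd: "is_OfflinePCPD \<Omega> p0 p1 \<epsilon> n X ktilde" and \<beta>: "\<beta> > 0" for \<epsilon> ktilde \<beta>
  proof (cases "\<beta> < 1")
    case False
    then show ?thesis by (intro accurate_trivial) simp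
  next
    case True
    let ?\<alpha> = "max (8 * A\<^sup>2 / C\<^sup>2 * ln (64 / (3 * \<beta>))) (4 * A / (C * \<epsilon>) * ln (16 / \<beta>))"
    define a where "a = nat \<lceil>?\<alpha>\<rceil>"
    \<comment> \<open>For \<open>\<beta> < 1\<close> both logarithms are positive. This makes
      \<open>a\<close> a genuine block length.\<close>
    have "?\<alpha> > 0" using A C \<epsilon> \<beta> True by (simp add: less_max_iff_disj)
    then have a: "0 < a" "8 * A\<^sup>2 / C\<^sup>2 * ln (64 / (3 * \<beta>)) \<le> a" "4 * A / (C * \<epsilon>) * ln (16 / \<beta>) \<le> a"
      unfolding a_def by linarith+
    obtain Z :: "nat \<Rightarrow> 'w \<Rightarrow> real" where indZ: "indep_vars (\<lambda>_. borel) Z {1..n}"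
      and lapZ: "\<And>k. k \<in> {1..n} \<Longrightarrow> laplace_rv (A / \<epsilon>) (Z k)"
      and indXZ: "indep_var (PiM {1..n} (\<lambda>_. borel)) (\<lambda>\<omega>. \<lambda>i\<in>{1..n}. X i \<omega>)
          (PiM {1..n} (\<lambda>_. borel)) (\<lambda>\<omega>. \<lambda>k\<in>{1..n}. Z k \<omega>)"
      and argmax: "\<And>\<omega>. \<omega> \<in> space \<Omega> \<Longrightarrow> is_arg_max (\<lambda>k. \<Lambda> \<omega> k + Z k \<omega>) (\<lambda>k. k \<in> {1..n}) (ktilde \<omega>)"
      using pcpd unfolding is_OfflinePCPD_def laplace_rv_def \<Lambda>_def assms(12) by blast
    have ktilde: "ktilde \<in> measurable \<Omega> (count_space UNIV)"
      "\<And>\<omega>. \<omega> \<in> space \<Omega> \<Longrightarrow> ktilde \<omega> \<in> {1..n}"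
      using pcpd argmax by (auto simp: is_OfflinePCPD_def is_arg_max_def)
    have max: "\<Lambda> \<omega> k + Z k \<omega> \<le> \<Lambda> \<omega> (ktilde \<omega>) + Z (ktilde \<omega>) \<omega>"
      if "\<omega> \<in> space \<Omega>" "k \<in> {1..n}" for \<omega> k
      using argmax[OF that(1)] that(2) by (auto simp: is_arg_max_linorder)
    \<comment> \<open>Noise is renumbered by distance, with distance \<open>0\<close> for
      \<open>kstar\<close> itself; hence one more noise variable than walk steps on each
      side.\<close>
    let ?ZR = "\<lambda>m \<omega>. Z (kstar + m) \<omega>"
    let ?ZQ = "\<lambda>m \<omega>. Z (kstar - m) \<omega>"
    have indZR: "indep_vars (\<lambda>_. borel) ?ZR {..n - kstar}"
      by (rule indep_vars_inj_reindex[OF indZ]) (use ks in auto)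
    have indZQ: "indep_vars (\<lambda>_. borel) ?ZQ {..kstar - 1}"
      by (rule indep_vars_inj_reindex[OF indZ]) (use ks in \<open>auto simp: inj_on_def\<close>)
    have lapR: "laplace_rv (A / \<epsilon>) (?ZR m)" if "m \<le> n - kstar" for m
      by (rule lapZ) (use that ks in auto)
    have lapQ: "laplace_rv (A / \<epsilon>) (?ZQ m)" if "m \<le> kstar - 1" for m
      by (rule lapZ) (use that ks in auto)
    have indRZ: "indep_var (PiM {..<n - kstar} (\<lambda>_. borel)) (\<lambda>\<omega>. \<lambda>i\<in>{..<n - kstar}. ?R i \<omega>)
        (PiM {..n - kstar} (\<lambda>_. borel)) (\<lambda>\<omega>. \<lambda>i\<in>{..n - kstar}. ?ZR i \<omega>)"
      by (rule indep_var_reindex_compose[OF indXZ]) (use ks in auto)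
    have indQZ: "indep_var (PiM {..<kstar - 1} (\<lambda>_. borel)) (\<lambda>\<omega>. \<lambda>i\<in>{..<kstar - 1}. ?Q i \<omega>)
        (PiM {..kstar - 1} (\<lambda>_. borel)) (\<lambda>\<omega>. \<lambda>i\<in>{..kstar - 1}. ?ZQ i \<omega>)"
      by (rule indep_var_reindex_compose[OF indXZ, where h = "\<lambda>x. - L x"]) (use ks in auto)
    have [measurable]: "?ZR m \<in> borel_measurable \<Omega>" if "m \<le> n - kstar" for m
      using lapR[OF that] by (rule laplace_rv_measurable)
    have [measurable]: "?ZQ m \<in> borel_measurable \<Omega>" if "m \<le> kstar - 1" for m
      using lapQ[OF that] by (rule laplace_rv_measurable)
    let ?F = "{\<omega>\<in>space \<Omega>. \<exists>m\<in>{a..n - kstar}. \<forall>j<a.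
      ?ZR m \<omega> - (\<Sum>i<m. ?R i \<omega>) \<ge> ?ZR j \<omega> - (\<Sum>i<j. ?R i \<omega>)}"
    let ?B = "{\<omega>\<in>space \<Omega>. \<exists>m\<in>{a..kstar - 1}. \<forall>j<a.
      ?ZQ m \<omega> - (\<Sum>i<m. ?Q i \<omega>) \<ge> ?ZQ j \<omega> - (\<Sum>i<j. ?Q i \<omega>)}"
    show ?thesis
    proof (rule accurateI[OF ktilde a_def])
      show "prob ?B \<le> \<beta> / 2"
        by (rule prob_noisy_walk_far_le[OF indQ rangeQ meanQ A C(1) \<epsilon> indZQ lapQ indQZ \<beta> True a])
      show "prob ?F \<le> \<beta> / 2"
        by (rule prob_noisy_walk_far_le[OF indR rangeR meanR A C(1) \<epsilon> indZR lapR indRZ \<beta> True a])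
      \<comment> \<open>If \<open>a\<close> exceeds the range, the event is empty; otherwise every
        \<open>j < a\<close> is in range, where scores and noise are measurable.\<close>
      show "?F \<in> events"
      proof (cases "a \<le> n - kstar")
        case True then show ?thesis by measurable
      qed (auto simp: not_le)
      show "?B \<in> events"
      proof (cases "a \<le> kstar - 1")
        case True then show ?thesis by measurable
      qed (auto simp: not_le)
      show "\<omega> \<in> ?F" if \<omega>: "\<omega> \<in> space \<Omega>" "ktilde \<omega> = kstar + m" "m \<in> {a..n - kstar}" for \<omega> m
      proof -
        have "?ZR m \<omega> - (\<Sum>i<m. ?R i \<omega>) \<ge> ?ZR j \<omega> - (\<Sum>i<j. ?R i \<omega>)" if "j < a" for j
        proof -
          \<comment> \<open>From \<open>j < a \<le> m\<close> the near competitor is an admissible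
            candidate, so the noisy maximum is at least its score.\<close>
          have "kstar + j \<in> {1..n}" using \<omega> that ks by auto
          from max[OF \<omega>(1) this] show ?thesis
            using \<omega> that \<Lambda>_right[of m \<omega>] \<Lambda>_right[of j \<omega>] by simp
        qed
        then show ?thesis using \<omega> by blast
      qed
      show "\<omega> \<in> ?B" if \<omega>: "\<omega> \<in> space \<Omega>" "ktilde \<omega> = kstar - m" "m \<in> {a..kstar - 1}" for \<omega> m
      proof -
        have "?ZQ m \<omega> - (\<Sum>i<m. ?Q i \<omega>) \<ge> ?ZQ j \<omega> - (\<Sum>i<j. ?Q i \<omega>)" if "j < a" for j
        proof -
          have "kstar - j \<in> {1..n}" using \<omega> that ks by auto
          from max[OF \<omega>(1) this] show ?thesis
            using \<omega> that \<Lambda>_left[of m \<omega>] \<Lambda>_left[of j \<omega>] by simp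
        qed
        then show ?thesis using \<omega> by blast
      qed
    qed
  qed
  ultimately show ?thesis by blast
qed

end
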